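(* For every $p\in[1,2)$ there exists a constant $C_p>0$ such that for every $n\in\mathbb N$, $n\ge 1$, and every $A\in M_2(\mathbb C)^{\otimes n}$ with operator norm $\|A\|\le1$, $$\operatorname{Var}(A)\le C_p\sum_{j=1}^n\frac{\|d_jA\|_p^p\,(1+\|d_jA\|_p^p)}{1+\log^+(1/\|d_jA\|_p^p)} .$$ Moreover the constants can be chosen of order $C_p\sim C/(2-p)$ as $p\nearrow2$, for some constant $C>0$. In particular, for $p=1$, there is a universal constant $C>0$ such that $\operatorname{Var}(A)\le C\sum_{j=1}^n\frac{\|d_jA\|_1(1+\|d_jA\|_1)}{1+\log^+(1/\|d_jA\|_1)}$ for all such $n$ and $A$.
   Context: $M_2(\mathbb{C})^{\otimes n}\cong M_{2^n}(\mathbb{C})$ is the algebra of operators on $n$ qubits, with operator norm $\|\cdot\|$, trace $\operatorname{tr}$ and identity $\mathbf 1$. Normalized Schatten norm: $\|A\|_p=(2^{-n}\operatorname{tr}|A|^p)^{1/p}$. $\operatorname{Var}(A)=\|A-2^{-n}\operatorname{tr}(A)\mathbf 1\|_2^2$. For $1\le j\le n$, $d_j=\mathbb I^{\otimes(j-1)}\otimes(\mathbb I-\tfrac12\operatorname{tr}(\cdot)\mathbf 1)\otimes\mathbb I^{\otimes(n-j)}$, where $\mathbb I$ is the identity map on $M_2(\mathbb{C})$. $\log^+$ is the positive part of the natural logarithm; a summand with $d_jA=0$ is interpreted as $0$. *)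

theory Defs
  imports
    "Jordan_Normal_Form.Char_Poly"
    "Jordan_Normal_Form.Schur_Decomposition"
    "HOL-Library.Landau_Symbols"
begin

definition mat_trace :: "complex mat \<Rightarrow> complex" where
  "mat_trace A = (\<Sum>i<dim_row A. A $$ (i, i))"

definition vec_norm2 :: "complex vec \<Rightarrow> real" where
  "vec_norm2 v = sqrt (Re (v \<bullet>c v))"

definition op_norm :: "complex mat \<Rightarrow> real" where
  "op_norm A = Sup {vec_norm2 (A *\<^sub>v v) | v. v \<in> carrier_vec (dim_col A) \<and> vec_norm2 v = 1}"

text \<open>Functional calculus \<open>f(H)\<close> of a Hermitian matrix \<open>H\<close>: the matrix acting as the scalar
  \<open>f l\<close> on the eigenspace of \<open>H\<close> for each eigenvalue \<open>l\<close>. It is unique and exists because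
  the eigenvalues of \<open>H\<close> are real and its eigenspaces decompose the whole space. For other
  matrices the value is of no significance.\<close>

definition mat_fun :: "(real \<Rightarrow> real) \<Rightarrow> complex mat \<Rightarrow> complex mat" where
  "mat_fun f H = (THE B. B \<in> carrier_mat (dim_row H) (dim_row H) \<and>
     (\<forall>v l. eigenvector H v (complex_of_real l) \<longrightarrow> B *\<^sub>v v = complex_of_real (f l) \<cdot>\<^sub>v v))"

definition mat_abs :: "complex mat \<Rightarrow> complex mat" where
  "mat_abs A = mat_fun sqrt (mat_adjoint A * A)"

definition schatten_norm :: "nat \<Rightarrow> real \<Rightarrow> complex mat \<Rightarrow> real" where
  "schatten_norm n p A =
     (Re (mat_trace (mat_fun (\<lambda>l. l powr p) (mat_abs A))) / 2 ^ n) powr (1 / p)"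

definition mat_var :: "nat \<Rightarrow> complex mat \<Rightarrow> real" where
  "mat_var n A = (schatten_norm n 2 (A - (mat_trace A / 2 ^ n) \<cdot>\<^sub>m 1\<^sub>m (2 ^ n)))\<^sup>2"

text \<open>Operators on \<open>n\<close> qubits are \<open>2 ^ n \<times> 2 ^ n\<close> matrices. Under the usual Kronecker
  identification the tensor factors \<open>1, \<dots>, n\<close> correspond to the binary digits of a row or column
  index, factor \<open>1\<close> being the most significant one; so factor \<open>j\<close> is bit \<open>n - j\<close>.\<close>

definition site_bit :: "nat \<Rightarrow> nat \<Rightarrow> nat \<Rightarrow> nat" where
  "site_bit n j i = of_bool (bit i (n - j))"

definition site_put :: "nat \<Rightarrow> nat \<Rightarrow> nat \<Rightarrow> nat \<Rightarrow> nat" where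
  "site_put n j a i = (if a = 0 then unset_bit (n - j) i else set_bit (n - j) i)"

definition site_block :: "nat \<Rightarrow> nat \<Rightarrow> complex mat \<Rightarrow> nat \<Rightarrow> nat \<Rightarrow> complex mat" where
  "site_block n j A r c = mat 2 2 (\<lambda>(a, b). A $$ (site_put n j a r, site_put n j b c))"

text \<open>For a linear map \<open>\<Phi>\<close> on \<open>2 \<times> 2\<close> matrices, \<open>site_map n j \<Phi>\<close> is the tensor product of
  \<open>\<Phi>\<close> on factor \<open>j\<close> with the identity map on all other factors: with all digits other than the
  \<open>j\<close>-th fixed, the entries of \<open>A\<close> form a \<open>2 \<times> 2\<close> block, to which \<open>\<Phi>\<close> is applied.
  See \<open>site_map_pure_tensor\<close> below.\<close>

definition site_map ::
    "nat \<Rightarrow> nat \<Rightarrow> (complex mat \<Rightarrow> complex mat) \<Rightarrow> complex mat \<Rightarrow> complex mat" where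
  "site_map n j \<Phi> A = mat (2 ^ n) (2 ^ n)
     (\<lambda>(r, c). \<Phi> (site_block n j A r c) $$ (site_bit n j r, site_bit n j c))"

definition d_site :: "nat \<Rightarrow> nat \<Rightarrow> complex mat \<Rightarrow> complex mat" where
  "d_site n j = site_map n j (\<lambda>X. X - (mat_trace X / 2) \<cdot>\<^sub>m 1\<^sub>m 2)"

definition log_plus :: "real \<Rightarrow> real" where
  "log_plus x = max 0 (ln x)"

text \<open>The Kronecker product of \<open>2 \<times> 2\<close> matrices \<open>F 1, \<dots>, F n\<close>.\<close>

definition pure_tensor :: "nat \<Rightarrow> (nat \<Rightarrow> complex mat) \<Rightarrow> complex mat" where
  "pure_tensor n F = mat (2 ^ n) (2 ^ n)
     (\<lambda>(r, c). \<Prod>j = 1..n. F j $$ (site_bit n j r, site_bit n j c))"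

lemma site_put_less:
  assumes "i < 2 ^ n" and "1 \<le> j" and "j \<le> n"
  shows "site_put n j a i < 2 ^ n"
proof -
  have "take_bit n (site_put n j a i) = site_put n j a i"
    using assms
    by (auto simp: site_put_def take_bit_set_bit_eq take_bit_unset_bit_eq take_bit_nat_eq_self)
  then show ?thesis by (simp add: take_bit_nat_eq_self_iff)
qed

lemma site_bit_put:
  assumes "1 \<le> j" and "j \<le> n" and "1 \<le> k" and "k \<le> n" and "a < 2"
  shows "site_bit n k (site_put n j a i) = (if k = j then a else site_bit n k i)"
proof -
  have "n - k = n - j \<longleftrightarrow> k = j" using assms by auto
  moreover have "a = 0 \<or> a = 1" using assms by auto
  ultimately show ?thesis
    by (auto simp: site_bit_def site_put_def bit_set_bit_iff bit_unset_bit_iff)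
qed

lemma site_map_pure_tensor:
  assumes j: "1 \<le> j" "j \<le> n"
    and F: "F j \<in> carrier_mat 2 2"
    and \<Phi>: "\<Phi> (F j) \<in> carrier_mat 2 2" "\<And>c. \<Phi> (c \<cdot>\<^sub>m F j) = c \<cdot>\<^sub>m \<Phi> (F j)"
  shows "site_map n j \<Phi> (pure_tensor n F) = pure_tensor n (F(j := \<Phi> (F j)))"
proof (rule eq_matI)
  fix r c
  assume "r < dim_row (pure_tensor n (F(j := \<Phi> (F j))))"
    and "c < dim_col (pure_tensor n (F(j := \<Phi> (F j))))"
  then have rc: "r < 2 ^ n" "c < 2 ^ n" by (auto simp: pure_tensor_def)
  define z where "z = (\<Prod>k \<in> {1..n} - {j}. F k $$ (site_bit n k r, site_bit n k c))"
  have split: "(\<Prod>k = 1..n. g k) = g j * (\<Prod>k \<in> {1..n} - {j}. g k)" for g :: "nat \<Rightarrow> complex"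
    using j by (intro prod.remove) auto
  have "site_block n j (pure_tensor n F) r c = z \<cdot>\<^sub>m F j"
  proof (rule eq_matI)
    fix a b assume "a < dim_row (z \<cdot>\<^sub>m F j)" and "b < dim_col (z \<cdot>\<^sub>m F j)"
    then have ab: "a < 2" "b < 2" using F by auto
    have "(\<Prod>k \<in> {1..n} - {j}. F k $$ (site_bit n k (site_put n j a r),
        site_bit n k (site_put n j b c))) = z"
      unfolding z_def using j ab by (intro prod.cong) (auto simp: site_bit_put)
    then show "site_block n j (pure_tensor n F) r c $$ (a, b) = (z \<cdot>\<^sub>m F j) $$ (a, b)"
      using ab F j rc
      by (simp add: site_block_def pure_tensor_def site_put_less split[unfolded One_nat_def] site_bit_put)
  qed (use F in \<open>auto simp: site_block_def\<close>)
  moreover have "site_bit n j i < 2" for i by (simp add: site_bit_def)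
  moreover have "(\<Prod>k \<in> {1..n} - {j}. (F(j := \<Phi> (F j))) k $$ (site_bit n k r, site_bit n k c)) = z"
    unfolding z_def by (intro prod.cong) auto
  ultimately show "site_map n j \<Phi> (pure_tensor n F) $$ (r, c)
      = pure_tensor n (F(j := \<Phi> (F j))) $$ (r, c)"
    using rc \<Phi> by (simp add: site_map_def pure_tensor_def split[unfolded One_nat_def])
qed (auto simp: site_map_def pure_tensor_def)

end

theory Submission
  imports Defs "HOL-Analysis.L2_Norm"
begin

text \<open>Expand \<open>A\<close> in Pauli strings \<open>P\<close>, with coefficients \<open>c\<^sub>P\<close> and weights \<open>|P|\<close>
  (the number of sites where \<open>P\<close> is not the identity). The coefficients of \<open>d\<^sub>j A\<close> are those
  \<open>c\<^sub>P\<close> with \<open>P j \<noteq> 0\<close>, so \<open>Var A\<close> is the sum over \<open>j\<close> of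
  \<open>V\<^sub>j = \<Sum> |c\<^sub>P|\<^sup>2 / |P|\<close> over these \<open>P\<close>. The levels above \<open>m\<close> contribute at most
  \<open>\<parallel>d\<^sub>j A\<parallel>\<^sub>2\<^sup>2 / (m + 1)\<close> to \<open>V\<^sub>j\<close>. For the low levels, a noncommutative Bonami lemma (from the
  2-norm to the 4-norm, with damping \<open>12 ^ (- |P| / 2)\<close>), dualised against the trace norm, gives at
  most \<open>12 ^ m \<parallel>d\<^sub>j A\<parallel>\<^sub>1 \<parallel>d\<^sub>j A\<parallel>\<^sub>2\<close>. Write \<open>a = \<parallel>d\<^sub>j A\<parallel>\<^sub>p\<^sup>p\<close>. Because \<open>\<parallel>d\<^sub>j A\<parallel> \<le> 2\<close>,
  the squared 2-norm is at most \<open>2 a\<close> and the low level term is of order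
  \<open>12 ^ m a ^ (1 / 2 + 1 / p)\<close>; taking \<open>m\<close> a small multiple of \<open>(2 - p) log (1 / a)\<close> gives the
  claim with the constant \<open>120 / (2 - p)\<close>.\<close>

section \<open>Spectral theorem for Hermitian matrices\<close>

text \<open>The exponent 4 is chosen because the fourth power of that norm is the trace of a product
  of four factors: it is multilinear, factorises over sites, and is controlled by Cauchy-Schwarz
  alone. Its dual exponent 4/3 lies halfway, in terms of reciprocals, between 1 and 2; this is why
  the squared dual estimate produces the product of the trace norm and the 2-norm. The obstacle is
  the growth \<open>12 ^ m\<close>. The only decay available to pay for it is the excess of the
  exponent \<open>1 / 2 + 1 / p\<close> over 1, namely \<open>(2 - p) / (2 * p)\<close>, positive
  exactly for \<open>p < 2\<close>. This forces \<open>m\<close> to be proportional to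
  \<open>(2 - p) * ln (1 / a)\<close>, and the tail \<open>1 / (m + 1)\<close> of the high levels
  then costs the factor \<open>1 / (2 - p)\<close>. The base 12 only influences the choice of the
  proportionality constant, so crude constants in the hypercontractive step do no harm. Sharing each
  squared coefficient equally among the sites of its support gives an exact identity for the
  variance, in place of an integral along a semigroup.\<close>

lemma mat_adjoint_dim [simp]: "dim_row (mat_adjoint A) = dim_col A" "dim_col (mat_adjoint A) = dim_row A"
  by (auto simp: mat_adjoint_def)

lemma mat_adjoint_index [simp]:
  "i < dim_col A \<Longrightarrow> j < dim_row A \<Longrightarrow> mat_adjoint A $$ (i, j) = cnj (A $$ (j, i))" for A :: "complex mat"
  by (simp add: mat_adjoint_def mat_of_rows_index)

lemma mat_adjoint_carrier [simp]: "A \<in> carrier_mat n m \<Longrightarrow> mat_adjoint A \<in> carrier_mat m n"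
  by auto

lemma mat_adjoint_mult:
  fixes A B :: "complex mat"
  assumes "A \<in> carrier_mat n m" "B \<in> carrier_mat m k"
  shows "mat_adjoint (A * B) = mat_adjoint B * mat_adjoint A"
  using assms by (intro eq_matI) (auto simp: scalar_prod_def mult.commute)

lemma mat_adjoint_adjoint [simp]: "mat_adjoint (mat_adjoint A) = (A :: complex mat)"
  by (intro eq_matI) auto

lemma mat_adjoint_four_block:
  fixes A B C D :: "complex mat"
  assumes "A \<in> carrier_mat a b" "B \<in> carrier_mat a d" "C \<in> carrier_mat c b" "D \<in> carrier_mat c d"
  shows "mat_adjoint (four_block_mat A B C D)
    = four_block_mat (mat_adjoint A) (mat_adjoint C) (mat_adjoint B) (mat_adjoint D)"
  using assms by (intro eq_matI) auto

text \<open>Gram-Schmidt applied to a basis starting with \<open>v\<close> leaves \<open>v\<close>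
  in first place and gives orthogonal vectors of arbitrary length; dividing each by its length makes
  the matrix of columns unitary. The scalar \<open>k\<close> is the reciprocal of the length of
  \<open>v\<close>.\<close>

lemma exists_unitary_first_col:
  assumes v: "(v :: complex vec) \<in> carrier_vec n" "v \<noteq> 0\<^sub>v n"
  shows "\<exists>W k. W \<in> carrier_mat n n \<and> mat_adjoint W * W = 1\<^sub>m n \<and> col W 0 = k \<cdot>\<^sub>v v \<and> n > 0"
proof -
  interpret cof_vec_space n "TYPE(complex)" .
  define b where "b = basis_completion v"
  define ws where "ws = gram_schmidt n b"
  from basis_completion[OF v, folded b_def]
  have b: "distinct b" "\<not> lin_dep (set b)" "set b \<subseteq> carrier_vec n" "hd b = v" "length b = n" by auto
  have n: "n > 0"
  proof (rule ccontr)
    assume "\<not> n > 0"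
    then have "v = 0\<^sub>v n" using v(1) by (intro eq_vecI) auto
    then show False using v(2) by simp
  qed
  from b n obtain vs where bv: "b = v # vs" by (cases b) auto
  from gram_schmidt_result[OF b(3,1,2) refl, folded ws_def]
  have ws: "set ws \<subseteq> carrier_vec n" "corthogonal ws" "length ws = n" using b by auto
  have hdws: "hd ws = v" unfolding ws_def using gram_schmidt_hd[OF v(1), of vs] bv by simp
  define W where "W = mat n n (\<lambda>(i, j). ws ! j $ i / of_real (vec_norm2 (ws ! j)))"
  have dim: "dim_vec (ws ! j) = n" if "j < n" for j
    using ws that by (metis carrier_vecD nth_mem subset_iff)
  have sp: "ws ! j \<bullet>c ws ! i = (\<Sum>k<n. ws ! j $ k * cnj (ws ! i $ k))" if "i < n" "j < n" for i j
    using dim[OF that(1)] dim[OF that(2)] by (simp add: scalar_prod_def lessThan_atLeast0)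
  have norm: "of_real (vec_norm2 (ws ! j)) * of_real (vec_norm2 (ws ! j)) = ws ! j \<bullet>c ws ! j" if "j < n" for j
  proof -
    have *: "ws ! j \<bullet>c ws ! j = of_real (\<Sum>k<n. (cmod (ws ! j $ k))\<^sup>2)"
      unfolding sp[OF that that] of_real_sum complex_norm_square ..
    show ?thesis
      unfolding vec_norm2_def * by (simp add: of_real_mult[symmetric] sum_nonneg del: of_real_mult)
  qed
  have ne: "vec_norm2 (ws ! j) \<noteq> 0" if "j < n" for j
    using norm[OF that] corthogonalD[OF ws(2), of j j] that ws(3) by auto
  have "mat_adjoint W * W = 1\<^sub>m n"
  proof (rule eq_matI)
    fix i j assume "i < dim_row (1\<^sub>m n)" "j < dim_col (1\<^sub>m n)"
    then have ij: "i < n" "j < n" by auto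
    have "(mat_adjoint W * W) $$ (i, j) = (\<Sum>k<n. ws ! j $ k * cnj (ws ! i $ k))
        / (of_real (vec_norm2 (ws ! i)) * of_real (vec_norm2 (ws ! j)))"
      using ij by (simp add: W_def scalar_prod_def sum_divide_distrib lessThan_atLeast0 mult.commute)
    also have "\<dots> = (1\<^sub>m n) $$ (i, j)"
    proof (cases "i = j")
      case True
      then show ?thesis
        using ij ne[OF ij(1)] unfolding sp[OF ij, symmetric] using norm[OF ij(1)] corthogonalD[OF ws(2), of j j] ij ws(3) by simp
    next
      case False
      then have "ws ! j \<bullet>c ws ! i = 0"
        using corthogonalD[OF ws(2), of j i] ij ws(3) by auto
      then show ?thesis using sp[OF ij] ij False by simp
    qed
    finally show "(mat_adjoint W * W) $$ (i, j) = (1\<^sub>m n) $$ (i, j)" .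
  qed (auto simp: W_def)
  moreover have "col W 0 = (1 / of_real (vec_norm2 (ws ! 0))) \<cdot>\<^sub>v v"
  proof -
    have "ws ! 0 = v" using hdws ws(3) n by (metis hd_conv_nth list.size(3) less_irrefl)
    then show ?thesis using n v(1) by (intro eq_vecI) (auto simp: W_def)
  qed
  ultimately show ?thesis using n by (intro exI[of _ W]) (auto simp: W_def)
qed

text \<open>Deflation: conjugating by a unitary whose first column is an eigenvector makes the first
  column of \<open>M\<close> a multiple of the first unit vector. Hermitian symmetry clears the
  first row as well, so a smaller Hermitian block \<open>K\<close> remains for the induction
  hypothesis.\<close>

lemma hermitian_diagonalization:
  fixes H :: "complex mat"
  assumes "H \<in> carrier_mat n n" "mat_adjoint H = H"
  shows "\<exists>V D. V \<in> carrier_mat n n \<and> D \<in> carrier_mat n n \<and> mat_adjoint V * V = 1\<^sub>m n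
    \<and> diagonal_mat D \<and> H = V * D * mat_adjoint V"
  using assms
proof (induction n arbitrary: H)
  case 0
  then show ?case
    by (intro exI[of _ "1\<^sub>m 0"]) (auto simp: diagonal_mat_def intro!: eq_matI)
next
  case (Suc n H)
  obtain as where as: "char_poly H = (\<Prod>a\<leftarrow>as. [:- a, 1:])" "length as = Suc n"
    using char_poly_factorized[OF Suc(2)] by blast
  then obtain e where "eigenvalue H e"
    unfolding eigenvalue_root_char_poly[OF Suc(2)] by (cases as) auto
  then obtain v where v: "v \<in> carrier_vec (Suc n)" "v \<noteq> 0\<^sub>v (Suc n)" "H *\<^sub>v v = e \<cdot>\<^sub>v v"
    using Suc(2) by (auto simp: eigenvalue_def eigenvector_def)
  obtain W k where W: "W \<in> carrier_mat (Suc n) (Suc n)" "mat_adjoint W * W = 1\<^sub>m (Suc n)" "col W 0 = k \<cdot>\<^sub>v v"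
    using exists_unitary_first_col[OF v(1,2)] by blast
  note H = Suc(2)
  have W': "mat_adjoint W \<in> carrier_mat (Suc n) (Suc n)" using W(1) by simp
  have WW: "W * mat_adjoint W = 1\<^sub>m (Suc n)"
    using mat_mult_left_right_inverse[OF W' W(1) W(2)] .
  define M where "M = mat_adjoint W * H * W"
  have M: "M \<in> carrier_mat (Suc n) (Suc n)" unfolding M_def by (intro mult_carrier_mat[of _ _ "Suc n"] W W' H)
  have Mh: "mat_adjoint M = M"
    unfolding M_def using W W' H Suc(3)
    by (simp add: mat_adjoint_mult[of _ "Suc n" "Suc n" _ "Suc n"] assoc_mult_mat[of _ "Suc n" "Suc n" _ "Suc n" _ "Suc n"] mult_carrier_mat[of _ "Suc n" "Suc n" _ "Suc n"])
  have HM: "H = W * M * mat_adjoint W"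
  proof -
    have "W * M * mat_adjoint W = (W * mat_adjoint W) * H * (W * mat_adjoint W)"
      unfolding M_def using W(1) W' H
      by (simp add: assoc_mult_mat[of _ "Suc n" "Suc n" _ "Suc n" _ "Suc n"] mult_carrier_mat[of _ "Suc n" "Suc n" _ "Suc n"])
    then show ?thesis using WW H by simp
  qed
  have col0: "col M 0 = e \<cdot>\<^sub>v unit_vec (Suc n) 0"
  proof -
    have "col M 0 = mat_adjoint W *\<^sub>v (H *\<^sub>v col W 0)"
      unfolding M_def using W(1) W' H
      by (simp only: assoc_mult_mat[OF W' H W(1)] col_mult2[OF W' mult_carrier_mat[OF H W(1)]] col_mult2[OF H W(1)] zero_less_Suc)
    also have "H *\<^sub>v col W 0 = e \<cdot>\<^sub>v col W 0"
      unfolding W(3) using H v by (simp add: mult_mat_vec smult_smult_assoc mult.commute)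
    also have "mat_adjoint W *\<^sub>v (e \<cdot>\<^sub>v col W 0) = e \<cdot>\<^sub>v (mat_adjoint W *\<^sub>v col W 0)"
      using W(1) W' v(1) by (intro mult_mat_vec) auto
    also have "mat_adjoint W *\<^sub>v col W 0 = col (mat_adjoint W * W) 0"
      by (rule col_mult2[OF W' W(1), symmetric]) simp
    finally show ?thesis using W(2) by simp
  qed
  have M0: "M $$ (i, 0) = (if i = 0 then e else 0)" if "i < Suc n" for i
    using arg_cong[OF col0, of "\<lambda>w. w $ i"] that M by auto
  have M0': "M $$ (0, i) = (if i = 0 then M $$ (0, 0) else 0)" if "i < Suc n" for i
    using M0[OF that] that M arg_cong[OF Mh, of "\<lambda>w. w $$ (0, i)"] by auto
  define K where "K = mat n n (\<lambda>(i, j). M $$ (Suc i, Suc j))"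
  have Mb: "M = four_block_mat (mat 1 1 (\<lambda>_. e)) (0\<^sub>m 1 n) (0\<^sub>m n 1) K"
    using M M0 M0' by (intro eq_matI) (auto simp: K_def less_Suc_eq_0_disj)
  have K: "K \<in> carrier_mat n n" by (simp add: K_def)
  have "mat_adjoint K = K"
  proof (rule eq_matI)
    fix i j assume "i < dim_row K" "j < dim_col K"
    then have ij: "i < n" "j < n" by (auto simp: K_def)
    then show "mat_adjoint K $$ (i, j) = K $$ (i, j)"
      using arg_cong[OF Mh, of "\<lambda>w. w $$ (Suc i, Suc j)"] M by (simp add: K_def)
  qed (auto simp: K_def)
  from Suc.IH[OF K this] obtain V D where VD: "V \<in> carrier_mat n n" "D \<in> carrier_mat n n"
    "mat_adjoint V * V = 1\<^sub>m n" "diagonal_mat D" "K = V * D * mat_adjoint V" by blast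
  let ?V = "four_block_mat (1\<^sub>m 1) (0\<^sub>m 1 n) (0\<^sub>m n 1) V"
  let ?D = "four_block_mat (mat 1 1 (\<lambda>_. e)) (0\<^sub>m 1 n) (0\<^sub>m n 1) D"
  have one: "mat_adjoint (1\<^sub>m m) = (1\<^sub>m m :: complex mat)" for m
    by (intro eq_matI) auto
  have zero: "mat_adjoint (0\<^sub>m m k) = (0\<^sub>m k m :: complex mat)" for m k
    by (intro eq_matI) auto
  have V: "?V \<in> carrier_mat (Suc n) (Suc n)" and D: "?D \<in> carrier_mat (Suc n) (Suc n)"
    using VD four_block_carrier_mat[of "1\<^sub>m 1" 1 1 V n n] four_block_carrier_mat[of "mat 1 1 (\<lambda>_. e)" 1 1 D n n] by auto
  have V': "mat_adjoint ?V = four_block_mat (1\<^sub>m 1) (0\<^sub>m 1 n) (0\<^sub>m n 1) (mat_adjoint V)"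
    using VD by (subst mat_adjoint_four_block[of _ 1 1 _ n _ n]) (auto simp: one zero)
  have VV: "mat_adjoint ?V * ?V = 1\<^sub>m (Suc n)"
    unfolding V' using VD
    by (subst mult_four_block_mat[of _ 1 1 _ n _ n _ _ 1 _ n]) (auto intro!: eq_matI)
  have MV: "M = ?V * ?D * mat_adjoint ?V"
    unfolding V' Mb VD(5) using VD(1,2)
    by (subst mult_four_block_mat[of _ 1 1 _ n _ n _ _ 1 _ n], auto)
      (subst mult_four_block_mat[of _ 1 1 _ n _ n _ _ 1 _ n], auto)
  show ?case
  proof (intro exI conjI)
    show "W * ?V \<in> carrier_mat (Suc n) (Suc n)" using W V by simp
    show "?D \<in> carrier_mat (Suc n) (Suc n)" by (rule D)
    have V'c: "mat_adjoint ?V \<in> carrier_mat (Suc n) (Suc n)" using V by (rule mat_adjoint_carrier)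
    have adj: "mat_adjoint (W * ?V) = mat_adjoint ?V * mat_adjoint W"
      using W(1) V by (rule mat_adjoint_mult)
    have "mat_adjoint (W * ?V) * (W * ?V) = mat_adjoint ?V * (mat_adjoint W * W) * ?V"
      unfolding adj using W(1) W' V V'c by (simp add: assoc_mult_mat[of _ "Suc n" "Suc n" _ "Suc n" _ "Suc n"] mult_carrier_mat[of _ "Suc n" "Suc n" _ "Suc n"] del: mat_adjoint_carrier)
    then show "mat_adjoint (W * ?V) * (W * ?V) = 1\<^sub>m (Suc n)"
      using VV by (simp only: W(2) right_mult_one_mat[OF V'c])
    show "diagonal_mat ?D"
      using VD(2,4) by (auto simp: diagonal_mat_def)
    show "H = W * ?V * ?D * mat_adjoint (W * ?V)"
      unfolding adj HM MV using W(1) W' V V'c D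
      by (simp add: assoc_mult_mat[of _ "Suc n" "Suc n" _ "Suc n" _ "Suc n"] mult_carrier_mat[of _ "Suc n" "Suc n" _ "Suc n"])
  qed
qed

section \<open>Frobenius and Schatten 4-norms\<close>

text \<open>Operators are handled here as index functions of which only the entries below
  \<open>N\<close> are read. Sums and scalar multiples are then pointwise and carry no dimension
  conditions; \<open>entries\<close> translates from matrices.\<close>

definition frob_inner :: "nat \<Rightarrow> (nat \<Rightarrow> nat \<Rightarrow> complex) \<Rightarrow> (nat \<Rightarrow> nat \<Rightarrow> complex) \<Rightarrow> complex" where
  "frob_inner N X Y = (\<Sum>r<N. \<Sum>c<N. cnj (X r c) * Y r c)"

definition frob_sq :: "nat \<Rightarrow> (nat \<Rightarrow> nat \<Rightarrow> complex) \<Rightarrow> real" where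
  "frob_sq N X = (\<Sum>r<N. \<Sum>c<N. (cmod (X r c))\<^sup>2)"

definition adj_mult :: "nat \<Rightarrow> (nat \<Rightarrow> nat \<Rightarrow> complex) \<Rightarrow> (nat \<Rightarrow> nat \<Rightarrow> complex) \<Rightarrow> nat \<Rightarrow> nat \<Rightarrow> complex" where
  "adj_mult N X Y = (\<lambda>a c. \<Sum>b<N. cnj (X b a) * Y b c)"

text \<open>\<open>adj_mult N X Y\<close> is \<open>X\<^sup>* Y\<close> and \<open>tr4 N X Y Z W\<close> is the trace of \<open>X\<^sup>* Y Z\<^sup>* W\<close>. The trace is
  not normalised.\<close>

definition tr4 where
  "tr4 N X Y Z W = (\<Sum>a<N. \<Sum>c<N. adj_mult N X Y a c * adj_mult N Z W c a)"

text \<open>The fourth power is the trace of the square of \<open>X\<^sup>* X\<close>, that is, the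
  sum of the fourth powers of the singular values: this is the unnormalised Schatten 4-norm.\<close>

definition norm4 where
  "norm4 N X = sqrt (sqrt (frob_sq N (adj_mult N X X)))"

lemma norm_sum_mult_le_L2_set:
  fixes f g :: "'a \<Rightarrow> complex"
  shows "cmod (\<Sum>i\<in>I. f i * g i) \<le> L2_set (\<lambda>i. cmod (f i)) I * L2_set (\<lambda>i. cmod (g i)) I"
proof -
  have "cmod (\<Sum>i\<in>I. f i * g i) \<le> (\<Sum>i\<in>I. \<bar>cmod (f i)\<bar> * \<bar>cmod (g i)\<bar>)"
    by (rule order_trans[OF norm_sum]) (simp add: norm_mult)
  also have "\<dots> \<le> L2_set (\<lambda>i. cmod (f i)) I * L2_set (\<lambda>i. cmod (g i)) I"
    by (rule L2_set_mult_ineq)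
  finally show ?thesis .
qed

lemma frob_sq_nonneg: "frob_sq N X \<ge> 0"
  by (simp add: frob_sq_def sum_nonneg)

lemma frob_inner_self: "frob_inner N X X = of_real (frob_sq N X)"
  unfolding frob_inner_def frob_sq_def of_real_sum complex_norm_square by (simp only: mult.commute)

lemma norm_sum2_mult_le:
  "cmod (\<Sum>r<N. \<Sum>c<N. X r c * Y r c) \<le> sqrt (frob_sq N X) * sqrt (frob_sq N Y)"
  using norm_sum_mult_le_L2_set[of "\<lambda>(r,c). X r c" "\<lambda>(r,c). Y r c" "{..<N} \<times> {..<N}"]
  by (simp add: frob_sq_def L2_set_def sum.cartesian_product case_prod_unfold)

lemma adj_mult_swap: "adj_mult N Z W c a = cnj (adj_mult N W Z a c)"
  by (simp add: adj_mult_def mult.commute)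

lemma norm_tr4_le_frob_sq:
  "cmod (tr4 N X Y Z W) \<le> sqrt (frob_sq N (adj_mult N X Y)) * sqrt (frob_sq N (adj_mult N W Z))"
proof -
  have "tr4 N X Y Z W = (\<Sum>a<N. \<Sum>c<N. adj_mult N X Y a c * (cnj (adj_mult N W Z a c)))"
    unfolding tr4_def by (simp add: adj_mult_swap[of N Z W])
  then show ?thesis
    using norm_sum2_mult_le[where X="adj_mult N X Y" and Y="\<lambda>a c. cnj (adj_mult N W Z a c)"]
    by (simp add: frob_sq_def)
qed

lemma sum_swap4:
  fixes f :: "nat \<Rightarrow> nat \<Rightarrow> nat \<Rightarrow> nat \<Rightarrow> 'a::comm_monoid_add"
  shows "(\<Sum>a<N. \<Sum>c<N. \<Sum>b<N. \<Sum>d<N. f a c b d) = (\<Sum>b<N. \<Sum>d<N. \<Sum>a<N. \<Sum>c<N. f a c b d)"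
proof -
  have "(\<Sum>a<N. \<Sum>c<N. \<Sum>b<N. \<Sum>d<N. f a c b d) = (\<Sum>a<N. \<Sum>b<N. \<Sum>c<N. \<Sum>d<N. f a c b d)"
    by (intro sum.cong refl sum.swap)
  also have "\<dots> = (\<Sum>b<N. \<Sum>a<N. \<Sum>c<N. \<Sum>d<N. f a c b d)"
    by (rule sum.swap)
  also have "\<dots> = (\<Sum>b<N. \<Sum>a<N. \<Sum>d<N. \<Sum>c<N. f a c b d)"
    by (intro sum.cong refl sum.swap)
  also have "\<dots> = (\<Sum>b<N. \<Sum>d<N. \<Sum>a<N. \<Sum>c<N. f a c b d)"
    by (intro sum.cong refl sum.swap)
  finally show ?thesis .
qed

definition mult_adj :: "nat \<Rightarrow> (nat \<Rightarrow> nat \<Rightarrow> complex) \<Rightarrow> nat \<Rightarrow> nat \<Rightarrow> complex" where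
  "mult_adj N X = (\<lambda>d b. \<Sum>a<N. X d a * cnj (X b a))"

text \<open>Cyclicity of the trace turns \<open>Y\<^sup>* X X\<^sup>* Y\<close> into the product of
  \<open>X X\<^sup>*\<close> and \<open>Y Y\<^sup>*\<close>. In this form \<open>X\<close> and
  \<open>Y\<close> are separated, so that Cauchy-Schwarz yields one 4-norm for each.\<close>

lemma frob_sq_adj_mult:
  "of_real (frob_sq N (adj_mult N X Y)) = (\<Sum>b<N. \<Sum>d<N. mult_adj N X d b * mult_adj N Y b d)"
proof -
  have "of_real (frob_sq N (adj_mult N X Y)) = (\<Sum>a<N. \<Sum>c<N. \<Sum>b<N. \<Sum>d<N.
      (X d a * cnj (X b a)) * (Y b c * cnj (Y d c)))"
    unfolding frob_inner_self[symmetric] frob_inner_def adj_mult_def cnj_sum complex_cnj_mult complex_cnj_cnj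
  proof (intro sum.cong refl)
    fix a c
    show "(\<Sum>b<N. X b a * cnj (Y b c)) * (\<Sum>b<N. cnj (X b a) * Y b c) =
        (\<Sum>b<N. \<Sum>d<N. X d a * cnj (X b a) * (Y b c * cnj (Y d c)))"
      by (subst sum_product, subst sum.swap) (simp only: mult_ac)
  qed
  also have "\<dots> = (\<Sum>b<N. \<Sum>d<N. \<Sum>a<N. \<Sum>c<N. (X d a * cnj (X b a)) * (Y b c * cnj (Y d c)))"
    by (rule sum_swap4)
  also have "\<dots> = (\<Sum>b<N. \<Sum>d<N. mult_adj N X d b * mult_adj N Y b d)"
    by (simp add: mult_adj_def sum_product)
  finally show ?thesis .
qed

lemma mult_adj_swap: "mult_adj N X d b = cnj (mult_adj N X b d)"
  by (simp add: mult_adj_def mult.commute)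

lemma frob_sq_mult_adj: "frob_sq N (mult_adj N X) = frob_sq N (adj_mult N X X)"
proof -
  have "of_real (frob_sq N (adj_mult N X X)) = (of_real (frob_sq N (mult_adj N X)) :: complex)"
    by (subst frob_sq_adj_mult, subst mult_adj_swap) (simp add: frob_inner_self[symmetric] frob_inner_def)
  then show ?thesis by (simp only: of_real_eq_iff)
qed

lemma norm4_nonneg: "norm4 N X \<ge> 0"
  by (simp add: norm4_def frob_sq_nonneg)

lemma norm4_sq: "(norm4 N X)\<^sup>2 = sqrt (frob_sq N (adj_mult N X X))"
  by (simp add: norm4_def frob_sq_nonneg)

lemma frob_sq_adj_mult_le: "sqrt (frob_sq N (adj_mult N X Y)) \<le> norm4 N X * norm4 N Y"
proof -
  have "frob_sq N (adj_mult N X Y) = cmod (\<Sum>b<N. \<Sum>d<N. cnj (mult_adj N X b d) * mult_adj N Y b d)"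
    using frob_sq_adj_mult[of N X Y] frob_sq_nonneg[of N "adj_mult N X Y"]
    by (subst (asm) mult_adj_swap) (metis abs_of_nonneg norm_of_real)
  also have "\<dots> \<le> sqrt (frob_sq N (\<lambda>b d. cnj (mult_adj N X b d))) * sqrt (frob_sq N (mult_adj N Y))"
    by (rule norm_sum2_mult_le)
  also have "\<dots> = (norm4 N X)\<^sup>2 * (norm4 N Y)\<^sup>2"
    by (simp add: norm4_sq frob_sq_mult_adj[symmetric]) (simp add: frob_sq_def)
  finally have "frob_sq N (adj_mult N X Y) \<le> (norm4 N X * norm4 N Y)\<^sup>2"
    by (simp add: power_mult_distrib)
  then show ?thesis
    by (simp add: norm4_nonneg real_le_lsqrt)
qed

text \<open>Hoelder's inequality with four exponents 4, by Cauchy-Schwarz on two scales: between the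
  pairs \<open>X, Y\<close> and \<open>Z, W\<close>, and then within each pair.\<close>

lemma norm_tr4_le: "cmod (tr4 N X Y Z W) \<le> norm4 N X * norm4 N Y * norm4 N Z * norm4 N W"
proof -
  have "cmod (tr4 N X Y Z W) \<le> (norm4 N X * norm4 N Y) * (norm4 N W * norm4 N Z)"
    by (rule order_trans[OF norm_tr4_le_frob_sq])
      (intro mult_mono frob_sq_adj_mult_le mult_nonneg_nonneg norm4_nonneg real_sqrt_ge_zero frob_sq_nonneg)
  then show ?thesis by (simp add: mult_ac)
qed

lemma tr4_self: "tr4 N X X X X = of_real (norm4 N X ^ 4)"
proof -
  have "norm4 N X ^ 4 = frob_sq N (adj_mult N X X)"
    using norm4_sq[of N X] frob_sq_nonneg[of N "adj_mult N X X"]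
    by (metis mult_2 numeral_Bit0 power_add power2_eq_square real_sqrt_pow2)
  moreover have "tr4 N X X X X = frob_inner N (adj_mult N X X) (adj_mult N X X)"
    unfolding tr4_def frob_inner_def
    by (subst (2) adj_mult_swap) (simp add: mult.commute)
  ultimately show ?thesis by (simp add: frob_inner_self)
qed

section \<open>Multilinearity of the fourfold trace and the triangle inequality for the
  4-norm\<close>

lemma adj_mult_add1: "adj_mult N (\<lambda>r c. X r c + X' r c) Y a b = adj_mult N X Y a b + adj_mult N X' Y a b"
  and adj_mult_add2: "adj_mult N Y (\<lambda>r c. X r c + X' r c) a b = adj_mult N Y X a b + adj_mult N Y X' a b"
  and adj_mult_scale1: "adj_mult N (\<lambda>r c. k * X r c) Y a b = cnj k * adj_mult N X Y a b"
  and adj_mult_scale2: "adj_mult N Y (\<lambda>r c. k * X r c) a b = k * adj_mult N Y X a b"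
  by (simp_all add: adj_mult_def algebra_simps sum.distrib sum_distrib_left)

lemma tr4_add:
  "tr4 N (\<lambda>r c. X r c + X' r c) Y Z W = tr4 N X Y Z W + tr4 N X' Y Z W"
  "tr4 N Y (\<lambda>r c. X r c + X' r c) Z W = tr4 N Y X Z W + tr4 N Y X' Z W"
  "tr4 N Y Z (\<lambda>r c. X r c + X' r c) W = tr4 N Y Z X W + tr4 N Y Z X' W"
  "tr4 N Y Z W (\<lambda>r c. X r c + X' r c) = tr4 N Y Z W X + tr4 N Y Z W X'"
  by (simp_all add: tr4_def adj_mult_add1 adj_mult_add2 algebra_simps sum.distrib)

lemma tr4_scale:
  "tr4 N (\<lambda>r c. k * X r c) Y Z W = cnj k * tr4 N X Y Z W"
  "tr4 N Y (\<lambda>r c. k * X r c) Z W = k * tr4 N Y X Z W"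
  "tr4 N Y Z (\<lambda>r c. k * X r c) W = cnj k * tr4 N Y Z X W"
  "tr4 N Y Z W (\<lambda>r c. k * X r c) = k * tr4 N Y Z W X"
  by (simp_all add: tr4_def adj_mult_scale1 adj_mult_scale2 mult_ac sum_distrib_left)

lemma tr4_zero:
  "tr4 N (\<lambda>r c. 0) Y Z W = 0"
  "tr4 N Y (\<lambda>r c. 0) Z W = 0"
  "tr4 N Y Z (\<lambda>r c. 0) W = 0"
  "tr4 N Y Z W (\<lambda>r c. 0) = 0"
  by (simp_all add: tr4_def adj_mult_def)

lemma tr4_sum:
  assumes "finite I"
  shows "tr4 N (\<lambda>r c. \<Sum>i\<in>I. f i r c) Y Z W = (\<Sum>i\<in>I. tr4 N (f i) Y Z W)"
  "tr4 N Y (\<lambda>r c. \<Sum>i\<in>I. f i r c) Z W = (\<Sum>i\<in>I. tr4 N Y (f i) Z W)"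
  "tr4 N Y Z (\<lambda>r c. \<Sum>i\<in>I. f i r c) W = (\<Sum>i\<in>I. tr4 N Y Z (f i) W)"
  "tr4 N Y Z W (\<lambda>r c. \<Sum>i\<in>I. f i r c) = (\<Sum>i\<in>I. tr4 N Y Z W (f i))"
  using assms by (induction I) (simp_all add: tr4_zero tr4_add)

lemma norm4_scale: "norm4 N (\<lambda>r c. k * X r c) = cmod k * norm4 N X"
proof -
  have "of_real (norm4 N (\<lambda>r c. k * X r c) ^ 4) = cnj k * k * (cnj k * k) * of_real (norm4 N X ^ 4)"
    by (simp only: tr4_self[symmetric] tr4_scale mult_ac)
  also have "\<dots> = of_real ((cmod k * norm4 N X) ^ 4)"
    by (simp add: complex_norm_square[symmetric] mult.commute[of "cnj k"] power_mult_distrib)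
  finally have "norm4 N (\<lambda>r c. k * X r c) ^ 4 = (cmod k * norm4 N X) ^ 4"
    by (simp only: of_real_eq_iff)
  then show ?thesis
    by (simp add: norm4_nonneg power_eq_iff_eq_base)
qed

text \<open>Minkowski from Hoelder: only the first slot of the trace of \<open>S, S, S, S\<close> is
  expanded, and the common factor \<open>norm4 N S ^ 3\<close> is cancelled.\<close>

lemma norm4_add: "norm4 N (\<lambda>r c. X r c + Y r c) \<le> norm4 N X + norm4 N Y"
proof -
  define S where "S = (\<lambda>r c. X r c + Y r c)"
  have "norm4 N S ^ 4 = cmod (tr4 N S S S S)"
    by (simp add: tr4_self norm4_nonneg norm_power)
  also have "tr4 N S S S S = tr4 N X S S S + tr4 N Y S S S"
    by (subst (1) S_def) (simp only: tr4_add)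
  also have "cmod \<dots> \<le> norm4 N X * norm4 N S * norm4 N S * norm4 N S
      + norm4 N Y * norm4 N S * norm4 N S * norm4 N S"
    by (rule order_trans[OF norm_triangle_ineq]) (intro add_mono norm_tr4_le)
  finally have *: "norm4 N S * norm4 N S ^ 3 \<le> (norm4 N X + norm4 N Y) * norm4 N S ^ 3"
    by (simp add: algebra_simps power_numeral_reduce)
  show ?thesis
  proof (cases "norm4 N S = 0")
    case True
    then show ?thesis by (simp add: S_def[symmetric] norm4_nonneg)
  next
    case False
    then have "norm4 N S ^ 3 > 0"
      using norm4_nonneg[of N S] by simp
    then show ?thesis using * by (simp add: S_def[symmetric])
  qed
qed

text \<open>Hoelder bounds the six terms of second order and the four of third order.\<close>

lemma norm4_add_le:
  assumes "tr4 N Z A A A = 0" "tr4 N A Z A A = 0" "tr4 N A A Z A = 0" "tr4 N A A A Z = 0"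
  shows "norm4 N (\<lambda>r c. A r c + Z r c) ^ 4
    \<le> norm4 N A ^ 4 + 8 * (norm4 N A)\<^sup>2 * (norm4 N Z)\<^sup>2 + 3 * norm4 N Z ^ 4"
proof -
  define S where "S = (\<lambda>r c. A r c + Z r c)"
  define a z where "a = norm4 N A" and "z = norm4 N Z"
  have nn: "a \<ge> 0" "z \<ge> 0" by (simp_all add: a_def z_def norm4_nonneg)
  have "norm4 N S ^ 4 = cmod (tr4 N S S S S)"
    by (simp add: tr4_self norm4_nonneg norm_power)
  also have "tr4 N S S S S = of_real (a ^ 4)
      + (tr4 N A A Z Z + tr4 N A Z A Z + tr4 N A Z Z A + tr4 N Z A A Z + tr4 N Z A Z A + tr4 N Z Z A A)
      + (tr4 N A Z Z Z + tr4 N Z A Z Z + tr4 N Z Z A Z + tr4 N Z Z Z A) + tr4 N Z Z Z Z"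
    unfolding S_def a_def tr4_self[symmetric] by (simp add: tr4_add assms)
  also have "cmod \<dots> \<le> a ^ 4 + (a*a*z*z + a*z*a*z + a*z*z*a + z*a*a*z + z*a*z*a + z*z*a*a)
      + (a*z*z*z + z*a*z*z + z*z*a*z + z*z*z*a) + z*z*z*z"
    unfolding a_def z_def
    by (intro norm_triangle_le add_mono norm_tr4_le) (simp add: norm_power norm4_nonneg)
  also have "\<dots> = a ^ 4 + 6 * a\<^sup>2 * z\<^sup>2 + 2 * z\<^sup>2 * (2 * a * z) + z ^ 4"
    by (simp add: power2_eq_square power4_eq_xxxx algebra_simps)
  \<comment> \<open>The odd term \<open>4 * a * z ^ 3\<close> is absorbed into its even neighbours,
    which raises their coefficients from 6 to 8 and from 1 to 3.\<close>
  also have "\<dots> \<le> a ^ 4 + 6 * a\<^sup>2 * z\<^sup>2 + 2 * z\<^sup>2 * (a\<^sup>2 + z\<^sup>2) + z ^ 4"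
    by (intro add_mono mult_left_mono sum_squares_bound) auto
  also have "\<dots> = a ^ 4 + 8 * a\<^sup>2 * z\<^sup>2 + 3 * z ^ 4"
    by (simp add: power2_eq_square power4_eq_xxxx algebra_simps)
  finally show ?thesis by (simp add: S_def a_def z_def)
qed

section \<open>Functional calculus and singular values\<close>

definition real_diag :: "nat \<Rightarrow> (nat \<Rightarrow> real) \<Rightarrow> complex mat" where
  "real_diag N d = mat N N (\<lambda>(i, j). if i = j then of_real (d i) else 0)"

lemma real_diag_carrier [simp]: "real_diag N d \<in> carrier_mat N N"
  by (simp add: real_diag_def)

lemma real_diag_mult_vec:
  assumes "w \<in> carrier_vec N" "i < N"
  shows "(real_diag N d *\<^sub>v w) $ i = of_real (d i) * w $ i"
proof -
  have "(real_diag N d *\<^sub>v w) $ i = (\<Sum>j<N. (if i = j then of_real (d i) else 0) * w $ j)"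
    using assms by (simp add: real_diag_def scalar_prod_def lessThan_atLeast0)
  also have "\<dots> = (\<Sum>j<N. if i = j then of_real (d i) * w $ j else 0)"
    by (intro sum.cong) auto
  also have "\<dots> = of_real (d i) * w $ i"
    using assms by simp
  finally show ?thesis .
qed

lemma unitary_conj_diag_col:
  assumes V: "V \<in> carrier_mat N N" "mat_adjoint V * V = 1\<^sub>m N" and "i < N"
  shows "(V * real_diag N d * mat_adjoint V) *\<^sub>v col V i = of_real (d i) \<cdot>\<^sub>v col V i"
proof -
  have V': "mat_adjoint V \<in> carrier_mat N N" using V by simp
  have c: "col V i \<in> carrier_vec N" using V assms by simp
  have "mat_adjoint V *\<^sub>v col V i = col (mat_adjoint V * V) i"
    by (rule col_mult2[OF V' V(1), symmetric]) fact
  then have e: "mat_adjoint V *\<^sub>v col V i = unit_vec N i" using V(2) assms by simp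
  have "real_diag N d *\<^sub>v unit_vec N i = of_real (d i) \<cdot>\<^sub>v unit_vec N i"
  proof (rule eq_vecI)
    fix k assume "k < dim_vec (of_real (d i) \<cdot>\<^sub>v unit_vec N i :: complex vec)"
    then have k: "k < N" by simp
    show "(real_diag N d *\<^sub>v unit_vec N i) $ k = (of_real (d i) \<cdot>\<^sub>v unit_vec N i) $ k"
      unfolding real_diag_mult_vec[OF unit_vec_carrier k] using k assms(3) by simp
  qed (simp add: real_diag_def)
  moreover have "(V * real_diag N d * mat_adjoint V) *\<^sub>v col V i = V *\<^sub>v (real_diag N d *\<^sub>v (mat_adjoint V *\<^sub>v col V i))"
    using V V' c by (simp add: assoc_mult_mat_vec[of _ N N _ N] mult_carrier_mat[of _ N N _ N] mult_mat_vec_carrier[of _ N N])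
  ultimately have "(V * real_diag N d * mat_adjoint V) *\<^sub>v col V i = of_real (d i) \<cdot>\<^sub>v (V *\<^sub>v unit_vec N i)"
    using e V by (simp add: mult_mat_vec)
  also have "V *\<^sub>v unit_vec N i = col V i"
  proof (rule eq_vecI)
    fix k assume "k < dim_vec (col V i)"
    then have "k < N" using V by simp
    then show "(V *\<^sub>v unit_vec N i) $ k = col V i $ k"
      using V assms by simp
  qed (use V in auto)
  finally show ?thesis .
qed

text \<open>The description by \<open>THE\<close> is resolved here. Existence: in the basis
  \<open>V\<close> an eigenvector for \<open>l\<close> has coordinate 0 wherever
  \<open>d i \<noteq> l\<close>, so scaling by \<open>f (d i)\<close> is scaling by
  \<open>f l\<close>, also when eigenvalues repeat. Uniqueness: the columns of \<open>V\<close> are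
  eigenvectors, so two candidates agree after multiplication by the invertible
  \<open>V\<close>.\<close>

lemma mat_fun_unitary_diag:
  assumes V: "V \<in> carrier_mat N N" "mat_adjoint V * V = 1\<^sub>m N"
  shows "mat_fun f (V * real_diag N d * mat_adjoint V) = V * real_diag N (\<lambda>i. f (d i)) * mat_adjoint V"
proof -
  have V': "mat_adjoint V \<in> carrier_mat N N" using V by simp
  have VV: "V * mat_adjoint V = 1\<^sub>m N" using mat_mult_left_right_inverse[OF V' V(1) V(2)] .
  define H where "H = V * real_diag N d * mat_adjoint V"
  define B where "B = V * real_diag N (\<lambda>i. f (d i)) * mat_adjoint V"
  have H: "H \<in> carrier_mat N N" and B: "B \<in> carrier_mat N N"
    unfolding H_def B_def by (intro mult_carrier_mat[of _ _ N] V V' real_diag_carrier)+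
  have mult_vec: "(V * real_diag N d * mat_adjoint V) *\<^sub>v v = V *\<^sub>v (real_diag N d *\<^sub>v (mat_adjoint V *\<^sub>v v))"
    if "v \<in> carrier_vec N" for v d
    using V V' that by (simp add: assoc_mult_mat_vec[of _ N N _ N] mult_carrier_mat[of _ N N _ N] mult_mat_vec_carrier[of _ N N])
  have cancel: "mat_adjoint V *\<^sub>v (V *\<^sub>v w) = w" "V *\<^sub>v (mat_adjoint V *\<^sub>v w) = w" if "w \<in> carrier_vec N" for w
    using assoc_mult_mat_vec[OF V' V(1) that] assoc_mult_mat_vec[OF V(1) V' that] V(2) VV that by auto
  have acts: "B *\<^sub>v v = of_real (f l) \<cdot>\<^sub>v v" if ev: "eigenvector H v (of_real l)" for v l
  proof -
    have v: "v \<in> carrier_vec N" "H *\<^sub>v v = of_real l \<cdot>\<^sub>v v"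
      using ev H by (auto simp: eigenvector_def)
    define w where "w = mat_adjoint V *\<^sub>v v"
    have w: "w \<in> carrier_vec N" using V' v by (auto simp: w_def)
    have vw: "v = V *\<^sub>v w" using cancel v by (simp add: w_def)
    have dw: "real_diag N d' *\<^sub>v w \<in> carrier_vec N" for d' using w by (intro mult_mat_vec_carrier[of _ N N]) auto
    have "real_diag N d *\<^sub>v w = mat_adjoint V *\<^sub>v (H *\<^sub>v v)"
      unfolding H_def mult_vec[OF v(1)] using cancel(1)[OF dw] by (simp add: w_def)
    also have "\<dots> = of_real l \<cdot>\<^sub>v w"
      unfolding v(2) w_def using V' v by (intro mult_mat_vec) auto
    finally have eq: "real_diag N d *\<^sub>v w = of_real l \<cdot>\<^sub>v w" .
    have "real_diag N (\<lambda>i. f (d i)) *\<^sub>v w = of_real (f l) \<cdot>\<^sub>v w"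
    proof (rule eq_vecI)
      fix i assume "i < dim_vec (of_real (f l) \<cdot>\<^sub>v w)"
      then have i: "i < N" using w by auto
      have "of_real (d i) * w $ i = of_real l * w $ i"
        using arg_cong[OF eq, of "\<lambda>x. x $ i"] i w by (simp add: real_diag_mult_vec)
      then show "(real_diag N (\<lambda>i. f (d i)) *\<^sub>v w) $ i = (of_real (f l) \<cdot>\<^sub>v w) $ i"
        using i w by (auto simp: real_diag_mult_vec)
    qed (use w in \<open>auto simp: real_diag_def\<close>)
    then have "B *\<^sub>v v = V *\<^sub>v (of_real (f l) \<cdot>\<^sub>v w)"
      unfolding B_def mult_vec[OF v(1)] by (simp add: w_def)
    also have "\<dots> = of_real (f l) \<cdot>\<^sub>v v"
      unfolding vw using V w by (intro mult_mat_vec) auto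
    finally show ?thesis .
  qed
  have unique: "B' = B" if B': "B' \<in> carrier_mat N N"
    "\<And>v l. eigenvector H v (of_real l) \<Longrightarrow> B' *\<^sub>v v = of_real (f l) \<cdot>\<^sub>v v" for B'
  proof -
    have "col (B' * V) i = col (B * V) i" if i: "i < N" for i
    proof -
      have "col V i \<noteq> 0\<^sub>v N"
      proof
        assume "col V i = 0\<^sub>v N"
        moreover have "(mat_adjoint V * V) $$ (i, i) = row (mat_adjoint V) i \<bullet> col V i"
          using V(1) i by simp
        moreover have "row (mat_adjoint V) i \<in> carrier_vec N" using V(1) i by simp
        ultimately have "(mat_adjoint V * V) $$ (i, i) = 0" by simp
        then show False using V i by simp
      qed
      then have "eigenvector H (col V i) (of_real (d i))"
        using H V i unitary_conj_diag_col[OF V i, of d] by (auto simp: eigenvector_def H_def)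
      then have "B' *\<^sub>v col V i = of_real (f (d i)) \<cdot>\<^sub>v col V i" by (rule B'(2))
      then show ?thesis
        using col_mult2[OF B'(1) V(1) i] col_mult2[OF B V(1) i] unitary_conj_diag_col[OF V i, of "\<lambda>i. f (d i)"]
        by (simp add: B_def)
    qed
    then have "B' * V = B * V"
      using B B' V by (intro mat_col_eqI) auto
    then have "B' * V * mat_adjoint V = B * V * mat_adjoint V" by simp
    then show ?thesis
      using B B' V V' VV by (simp add: assoc_mult_mat[of _ N N _ N _ N])
  qed
  have "mat_fun f H = B"
    unfolding mat_fun_def carrier_matD(1)[OF H]
    by (rule the_equality) (use B acts unique in blast)+
  then show ?thesis by (simp only: H_def B_def)
qed

lemma trace_unitary_diag:
  assumes V: "V \<in> carrier_mat N N" "mat_adjoint V * V = 1\<^sub>m N"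
  shows "mat_trace (V * real_diag N d * mat_adjoint V) = of_real (\<Sum>i<N. d i)"
proof -
  have VD: "(V * real_diag N d) $$ (r, i) = V $$ (r, i) * of_real (d i)" if "r < N" "i < N" for r i
  proof -
    have "(V * real_diag N d) $$ (r, i) = (\<Sum>k<N. if k = i then V $$ (r, k) * of_real (d k) else 0)"
    proof -
      have "(V * real_diag N d) $$ (r, i) = (\<Sum>k<N. V $$ (r, k) * (if k = i then of_real (d k) else 0))"
        using that V by (simp add: real_diag_def scalar_prod_def lessThan_atLeast0)
      also have "\<dots> = (\<Sum>k<N. if k = i then V $$ (r, k) * of_real (d k) else 0)"
        by (intro sum.cong) auto
      finally show ?thesis .
    qed
    then show ?thesis using that by simp
  qed
  have unit: "(\<Sum>r<N. cnj (V $$ (r, i)) * V $$ (r, i)) = 1" if "i < N" for i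
    using arg_cong[OF V(2), of "\<lambda>M. M $$ (i, i)"] that V(1) by (simp add: scalar_prod_def lessThan_atLeast0)
  have "mat_trace (V * real_diag N d * mat_adjoint V) = (\<Sum>r<N. \<Sum>i<N. (V * real_diag N d) $$ (r, i) * cnj (V $$ (r, i)))"
    using V(1) by (simp add: mat_trace_def scalar_prod_def lessThan_atLeast0 real_diag_def)
  also have "\<dots> = (\<Sum>r<N. \<Sum>i<N. of_real (d i) * (cnj (V $$ (r, i)) * V $$ (r, i)))"
    by (intro sum.cong refl) (simp add: VD)
  also have "\<dots> = (\<Sum>i<N. of_real (d i) * (\<Sum>r<N. cnj (V $$ (r, i)) * V $$ (r, i)))"
    by (subst sum.swap) (simp add: sum_distrib_left)
  finally show ?thesis by (simp add: unit)
qed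

definition apply_vec :: "nat \<Rightarrow> (nat \<Rightarrow> nat \<Rightarrow> complex) \<Rightarrow> (nat \<Rightarrow> complex) \<Rightarrow> nat \<Rightarrow> complex" where
  "apply_vec N X v = (\<lambda>r. \<Sum>c<N. X r c * v c)"

definition vec_l2 :: "nat \<Rightarrow> (nat \<Rightarrow> complex) \<Rightarrow> real" where
  "vec_l2 N v = L2_set (\<lambda>r. cmod (v r)) {..<N}"

definition entries :: "complex mat \<Rightarrow> nat \<Rightarrow> nat \<Rightarrow> complex" where
  "entries A r c = A $$ (r, c)"

text \<open>The completeness relation of an orthonormal basis, the sum of the projections
  \<open>u\<^sub>i u\<^sub>i\<^sup>*\<close> being the identity. Completeness rather than
  orthogonality is recorded because it is what gets inserted into traces.\<close>

definition resolves_identity :: "nat \<Rightarrow> (nat \<Rightarrow> nat \<Rightarrow> complex) \<Rightarrow> bool" where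
  "resolves_identity N u \<longleftrightarrow> (\<forall>r<N. \<forall>c<N. (\<Sum>i<N. u i r * cnj (u i c)) = of_bool (r = c))"

text \<open>Collects all that is used later about Schatten norms, so that the functional calculus
  can be left behind. The \<open>u i\<close> are an orthonormal eigenbasis of
  \<open>X\<^sup>* X\<close>. Since \<open>s i\<close> is the length of \<open>X\<close> applied to
  \<open>u i\<close>, its square is the \<open>i\<close>-th diagonal entry of \<open>D\<close>; this
  also shows that \<open>D\<close> is real and nonnegative.\<close>

lemma singular_values_exist:
  assumes X: "X \<in> carrier_mat N N"
  shows "\<exists>(u :: nat \<Rightarrow> nat \<Rightarrow> complex) (s :: nat \<Rightarrow> real).
      (\<forall>i. s i \<ge> 0) \<and> (\<forall>i<N. vec_l2 N (u i) = 1) \<and> (\<forall>i<N. vec_l2 N (apply_vec N (entries X) (u i)) = s i)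
    \<and> resolves_identity N u
    \<and> (\<forall>n p. schatten_norm n p X = ((\<Sum>i<N. s i powr p) / 2 ^ n) powr (1 / p))"
proof -
  define H where "H = mat_adjoint X * X"
  have X': "mat_adjoint X \<in> carrier_mat N N" using X by simp
  have H: "H \<in> carrier_mat N N" unfolding H_def by (intro mult_carrier_mat[of _ _ N] X X')
  have "mat_adjoint H = H" unfolding H_def using mat_adjoint_mult[OF X' X] by simp
  from hermitian_diagonalization[OF H this] obtain V D where V: "V \<in> carrier_mat N N" "mat_adjoint V * V = 1\<^sub>m N"
    and D: "D \<in> carrier_mat N N" "diagonal_mat D" "H = V * D * mat_adjoint V" by blast
  have V': "mat_adjoint V \<in> carrier_mat N N" using V by simp
  have VV: "V * mat_adjoint V = 1\<^sub>m N" using mat_mult_left_right_inverse[OF V' V(1) V(2)] .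
  define u where "u i r = V $$ (r, i)" for i r
  define s where "s i = vec_l2 N (apply_vec N (entries X) (u i))" for i
  have XV: "X * V \<in> carrier_mat N N" using X V by simp
  have XVe: "(X * V) $$ (r, i) = apply_vec N (entries X) (u i) r" if "r < N" "i < N" for r i
    using that X V by (simp add: apply_vec_def entries_def u_def scalar_prod_def lessThan_atLeast0)
  have "D = mat_adjoint V * H * V"
  proof -
    have "mat_adjoint V * H * V = (mat_adjoint V * V) * D * (mat_adjoint V * V)"
      unfolding D(3) using V(1) V' D(1)
      by (simp add: assoc_mult_mat[of _ N N _ N _ N] mult_carrier_mat[of _ N N _ N])
    then show ?thesis using V(2) D by simp
  qed
  also have "\<dots> = mat_adjoint (X * V) * (X * V)"
    unfolding mat_adjoint_mult[OF X V(1)] H_def using V(1) V' X X'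
    by (simp add: assoc_mult_mat[of _ N N _ N _ N] mult_carrier_mat[of _ N N _ N])
  finally have DX: "D = mat_adjoint (X * V) * (X * V)" .
  have Dii: "D $$ (i, i) = of_real ((s i)\<^sup>2)" if i: "i < N" for i
  proof -
    have "D $$ (i, i) = (\<Sum>r<N. cnj ((X * V) $$ (r, i)) * (X * V) $$ (r, i))"
      unfolding DX using XV X V i by (simp add: scalar_prod_def lessThan_atLeast0 del: index_mult_mat(1)) (simp add: scalar_prod_def)
    also have "\<dots> = of_real (\<Sum>r<N. (cmod (apply_vec N (entries X) (u i) r))\<^sup>2)"
      unfolding of_real_sum complex_norm_square using i by (intro sum.cong refl) (simp only: XVe mult.commute lessThan_iff)
    finally show ?thesis by (simp add: s_def vec_l2_def L2_set_def sum_nonneg)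
  qed
  have D_eq: "D = real_diag N (\<lambda>i. (s i)\<^sup>2)"
    using D(1,2) Dii by (intro eq_matI) (auto simp: real_diag_def diagonal_mat_def)
  have s: "s i \<ge> 0" for i by (simp add: s_def vec_l2_def)
  have abs: "mat_abs X = V * real_diag N s * mat_adjoint V"
    unfolding mat_abs_def H_def[symmetric] D(3) D_eq mat_fun_unitary_diag[OF V] by (simp add: s)
  have "schatten_norm n p X = ((\<Sum>i<N. s i powr p) / 2 ^ n) powr (1 / p)" for n p
    unfolding schatten_norm_def abs mat_fun_unitary_diag[OF V] trace_unitary_diag[OF V] Re_complex_of_real ..
  moreover have "(\<Sum>i<N. u i r * cnj (u i c)) = of_bool (r = c)" if "r < N" "c < N" for r c
    using arg_cong[OF VV, of "\<lambda>M. M $$ (r, c)"] that V(1) by (simp add: scalar_prod_def lessThan_atLeast0 u_def)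
  moreover have "vec_l2 N (u i) = 1" if i: "i < N" for i
  proof -
    have "of_real (\<Sum>r<N. (cmod (u i r))\<^sup>2) = (1 :: complex)"
      unfolding of_real_sum complex_norm_square
      using arg_cong[OF V(2), of "\<lambda>M. M $$ (i, i)"] i V(1)
      by (simp add: scalar_prod_def lessThan_atLeast0 u_def mult.commute)
    then have "(\<Sum>r<N. (cmod (u i r))\<^sup>2) = 1" by (simp only: of_real_eq_1_iff)
    then show ?thesis by (simp add: vec_l2_def L2_set_def)
  qed
  moreover have "vec_l2 N (apply_vec N (entries X) (u i)) = s i" for i by (simp only: s_def)
  ultimately show ?thesis using s by (intro exI[of _ u] exI[of _ s]) (unfold resolves_identity_def, blast)
qed

section \<open>Pauli strings\<close>

text \<open>The identity and the Pauli matrices X, Y, Z carry the indices 0, 1, 2, 3; the last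
  branch also assigns Z to every larger index.\<close>

definition pauli :: "nat \<Rightarrow> nat \<Rightarrow> nat \<Rightarrow> complex" where
  "pauli i a b =
    (if i = 0 then of_bool (a = b)
     else if i = 1 then of_bool (a \<noteq> b)
     else if i = 2 then (if a = b then 0 else if a = 0 then - \<i> else \<i>)
     else (if a \<noteq> b then 0 else if a = 0 then 1 else - 1))"

definition pauli_string :: "nat \<Rightarrow> (nat \<Rightarrow> nat) \<Rightarrow> nat \<Rightarrow> nat \<Rightarrow> complex" where
  "pauli_string n P r c = (\<Prod>j = 1..n. pauli (P j) (site_bit n j r) (site_bit n j c))"

text \<open>The default 0 outside \<open>{1..m}\<close> makes these sets finite and nested. An
  induction on \<open>m\<close> can thus run inside a fixed number \<open>n\<close> of qubits, with
  the identity on the sites not yet reached.\<close>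

definition pauli_index :: "nat \<Rightarrow> (nat \<Rightarrow> nat) set" where
  "pauli_index m = {P. (\<forall>j. P j < 4) \<and> (\<forall>j. j \<notin> {1..m} \<longrightarrow> P j = 0)}"

definition weight :: "(nat \<Rightarrow> nat) \<Rightarrow> nat" where
  "weight P = card {j. P j \<noteq> 0}"

lemma site_bit_less: "site_bit n j r < 2"
  by (simp add: site_bit_def)

lemma sum_lessThan_2: "(\<Sum>a<2. f a) = f 0 + f (1::nat)"
  by (simp add: numeral_2_eq_2)

lemma sum_lessThan_4: "(\<Sum>a<4. f a) = f 0 + f 1 + f 2 + f (3::nat)"
  by (simp add: eval_nat_numeral)

lemma sum_lessThan_double:
  fixes f :: "nat \<Rightarrow> 'a::comm_monoid_add"
  shows "(\<Sum>r<2 * N. f r) = (\<Sum>r<N. f (2 * r) + f (2 * r + 1))"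
  by (induction N) (simp_all add: add.assoc)

text \<open>An index below \<open>2 ^ n\<close> is the same as a choice of one bit per site, so the
  sum distributes over the product. The induction peels off the least significant bit, which belongs
  to the last site: passing from \<open>r\<close> to \<open>2 * r + b\<close> keeps the bits of all
  earlier sites.\<close>

lemma sum_prod_site_bit:
  fixes h :: "nat \<Rightarrow> nat \<Rightarrow> 'a::comm_semiring_1"
  shows "(\<Sum>r<2 ^ n. \<Prod>j = 1..n. h j (site_bit n j r)) = (\<Prod>j = 1..n. \<Sum>a<2. h j a)"
proof (induction n)
  case 0
  then show ?case by simp
next
  case (Suc n)
  have bits: "(\<Prod>j = 1..n. h j (site_bit (Suc n) j (2 * r + b))) = (\<Prod>j = 1..n. h j (site_bit n j r))"
    if "b < 2" for r b
    using that by (intro prod.cong refl) (auto simp: site_bit_def Suc_diff_le bit_Suc)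
  have last: "site_bit (Suc n) (Suc n) (2 * r) = 0" "site_bit (Suc n) (Suc n) (2 * r + 1) = 1" for r
    by (auto simp: site_bit_def bit_0)
  have "(\<Sum>r<2 ^ Suc n. \<Prod>j = 1..Suc n. h j (site_bit (Suc n) j r))
      = (\<Sum>r<2 ^ n. (\<Prod>j = 1..n. h j (site_bit n j r)) * (h (Suc n) 0 + h (Suc n) 1))"
    unfolding power_Suc sum_lessThan_double
  proof (intro sum.cong refl)
    fix r :: nat
    show "(\<Prod>j = 1..Suc n. h j (site_bit (Suc n) j (2 * r)))
        + (\<Prod>j = 1..Suc n. h j (site_bit (Suc n) j (2 * r + 1)))
        = (\<Prod>j = 1..n. h j (site_bit n j r)) * (h (Suc n) 0 + h (Suc n) 1)"
      using bits[of 0 r] bits[of 1 r] last[of r] by (simp add: algebra_simps)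
  qed
  also have "\<dots> = (\<Prod>j = 1..Suc n. \<Sum>a<2. h j a)"
    by (simp add: sum_distrib_right[symmetric] Suc.IH[unfolded One_nat_def] sum_lessThan_2)
  finally show ?case .
qed

lemma site_bit_inj:
  assumes "r < 2 ^ n" "c < 2 ^ n" "\<And>j. j \<in> {1..n} \<Longrightarrow> site_bit n j r = site_bit n j c"
  shows "r = c"
proof (rule bit_eqI)
  fix k
  show "bit r k = bit c k"
  proof (cases "k < n")
    case True
    then show ?thesis
      using assms(3)[of "n - k"] by (auto simp: site_bit_def of_bool_eq_iff)
  next
    case False
    have "\<not> bit x k" if "x < 2 ^ n" for x :: nat
      using that False by (metis bit_take_bit_iff take_bit_nat_eq_self)
    then show ?thesis using assms by blast
  qed
qed

section \<open>Sums over Pauli strings and their weights\<close>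

lemma pauli_index_0: "pauli_index 0 = {\<lambda>_. 0}"
  by (auto simp: pauli_index_def)

lemma sum_pauli_index_Suc:
  "(\<Sum>P\<in>pauli_index (Suc m). f P) = (\<Sum>P\<in>pauli_index m. \<Sum>i<4. f (P(Suc m := i)))"
  unfolding sum.cartesian_product
  by (rule sum.reindex_bij_witness[where i="\<lambda>(P,i). P(Suc m := i)" and j="\<lambda>P. (P(Suc m := 0), P (Suc m))"])
    (auto simp: pauli_index_def fun_eq_iff atLeastAtMostSuc_conv)

lemma finite_pauli_index: "finite (pauli_index m)"
proof (induction m)
  case 0
  then show ?case by (simp add: pauli_index_0)
next
  case (Suc m)
  have "pauli_index (Suc m) \<subseteq> (\<lambda>(P,i). P(Suc m := i)) ` (pauli_index m \<times> {..<4})"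
  proof
    fix P assume "P \<in> pauli_index (Suc m)"
    then have "P(Suc m := 0) \<in> pauli_index m" "P (Suc m) < 4"
      by (auto simp: pauli_index_def)
    then show "P \<in> (\<lambda>(P,i). P(Suc m := i)) ` (pauli_index m \<times> {..<4})"
      by (intro image_eqI[where x="(P(Suc m := 0), P (Suc m))"]) auto
  qed
  then show ?case using Suc finite_subset by blast
qed

lemma sum_prod_pauli_index:
  fixes g :: "nat \<Rightarrow> nat \<Rightarrow> 'a::comm_semiring_1"
  shows "(\<Sum>P\<in>pauli_index m. \<Prod>j = 1..m. g j (P j)) = (\<Prod>j = 1..m. \<Sum>i<4. g j i)"
proof (induction m)
  case 0
  then show ?case by (simp add: pauli_index_0)
next
  case (Suc m)
  have "(\<Prod>j = 1..m. g j ((P(Suc m := i)) j)) = (\<Prod>j = 1..m. g j (P j))" for P i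
    by (intro prod.cong) auto
  then show ?case
    by (simp add: sum_pauli_index_Suc Suc.IH[unfolded One_nat_def, symmetric] sum_product)
qed

lemma weight_upd:
  assumes "P \<in> pauli_index m"
  shows "weight (P(Suc m := i)) = weight P + of_bool (i \<noteq> 0)"
proof -
  have "finite {j. P j \<noteq> 0}" "Suc m \<notin> {j. P j \<noteq> 0}"
    using assms by (auto simp: pauli_index_def intro!: finite_subset[of _ "{1..m}"])
  moreover have "{j. (P(Suc m := i)) j \<noteq> 0} = (if i = 0 then {j. P j \<noteq> 0} else insert (Suc m) {j. P j \<noteq> 0})"
    using calculation(2) by auto
  ultimately show ?thesis by (simp add: weight_def)
qed

lemma weight_eq_sum:
  assumes "P \<in> pauli_index n"
  shows "weight P = (\<Sum>j = 1..n. of_bool (P j \<noteq> 0))"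
proof -
  have "{j. P j \<noteq> 0} = {1..n} \<inter> {j. P j \<noteq> 0}"
    using assms by (auto simp: pauli_index_def)
  then show ?thesis by (simp add: weight_def sum.If_cases of_bool_def)
qed

text \<open>The one-qubit completeness relation of the four matrices, multiplied over the sites. It
  gives the expansion of every operator directly, in place of a dimension count.\<close>

lemma pauli_string_completeness:
  assumes "r < 2 ^ n" "c < 2 ^ n" "r' < 2 ^ n" "c' < 2 ^ n"
  shows "(\<Sum>P\<in>pauli_index n. cnj (pauli_string n P r' c') * pauli_string n P r c)
    = 2 ^ n * of_bool (r = r' \<and> c = c')"
proof -
  have site: "(\<Sum>i<4. cnj (pauli i a' b') * pauli i a b) = 2 * of_bool (a = a' \<and> b = b')"
    if "a < 2" "b < 2" "a' < 2" "b' < 2" for a b a' b'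
    using that by (auto simp: sum_lessThan_4 pauli_def less_2_cases_iff)
  have "(\<Sum>P\<in>pauli_index n. cnj (pauli_string n P r' c') * pauli_string n P r c)
    = (\<Prod>j = 1..n. \<Sum>i<4. cnj (pauli i (site_bit n j r') (site_bit n j c'))
          * pauli i (site_bit n j r) (site_bit n j c))"
    unfolding sum_prod_pauli_index[symmetric] pauli_string_def by (simp add: prod.distrib)
  also have "\<dots> = (\<Prod>j = 1..n. 2 * of_bool (site_bit n j r = site_bit n j r' \<and> site_bit n j c = site_bit n j c'))"
    by (simp add: site site_bit_less)
  also have "\<dots> = 2 ^ n * of_bool (r = r' \<and> c = c')"
  proof (cases "r = r' \<and> c = c'")
    case True
    then show ?thesis by simp
  next
    case False
    then obtain j where "j \<in> {1..n}" "\<not> (site_bit n j r = site_bit n j r' \<and> site_bit n j c = site_bit n j c')"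
      using site_bit_inj assms by metis
    then have "(\<Prod>j = 1..n. 2 * of_bool (site_bit n j r = site_bit n j r' \<and> site_bit n j c = site_bit n j c')) = (0::complex)"
      by (intro prod_zero) auto
    then show ?thesis using False by simp
  qed
  finally show ?thesis .
qed

section \<open>Pauli expansion, orthogonality and Parseval\<close>

definition pauli_coeff :: "nat \<Rightarrow> (nat \<Rightarrow> nat \<Rightarrow> complex) \<Rightarrow> (nat \<Rightarrow> nat) \<Rightarrow> complex" where
  "pauli_coeff n X P = frob_inner (2 ^ n) (pauli_string n P) X / 2 ^ n"

definition pauli_comb :: "nat \<Rightarrow> ((nat \<Rightarrow> nat) \<Rightarrow> complex) \<Rightarrow> nat \<Rightarrow> nat \<Rightarrow> complex" where
  "pauli_comb n x r c = (\<Sum>P\<in>pauli_index n. x P * pauli_string n P r c)"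

lemma pauli_expansion:
  assumes "r < 2 ^ n" "c < 2 ^ n"
  shows "pauli_comb n (pauli_coeff n X) r c = X r c"
proof -
  let ?N = "2 ^ n :: nat"
  have "2 ^ n * pauli_comb n (pauli_coeff n X) r c
      = (\<Sum>P\<in>pauli_index n. (2 ^ n * pauli_coeff n X P) * pauli_string n P r c)"
    by (simp only: pauli_comb_def sum_distrib_left mult.assoc)
  also have "\<dots> = (\<Sum>P\<in>pauli_index n. \<Sum>r'<?N. \<Sum>c'<?N. X r' c' * (cnj (pauli_string n P r' c') * pauli_string n P r c))"
    by (intro sum.cong refl) (simp add: pauli_coeff_def frob_inner_def sum_distrib_right mult_ac, simp add: sum_distrib_left mult_ac)
  also have "\<dots> = (\<Sum>r'<?N. \<Sum>P\<in>pauli_index n. \<Sum>c'<?N. X r' c' * (cnj (pauli_string n P r' c') * pauli_string n P r c))"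
    by (rule sum.swap)
  also have "\<dots> = (\<Sum>r'<?N. \<Sum>c'<?N. \<Sum>P\<in>pauli_index n. X r' c' * (cnj (pauli_string n P r' c') * pauli_string n P r c))"
    by (intro sum.cong refl sum.swap)
  also have "\<dots> = (\<Sum>r'<?N. \<Sum>c'<?N. X r' c' * (2 ^ n * of_bool (r = r' \<and> c = c')))"
    unfolding sum_distrib_left[symmetric] using assms
    by (intro sum.cong refl) (simp add: pauli_string_completeness)
  also have "\<dots> = (\<Sum>r'<?N. if r = r' then X r' c * 2 ^ n else 0)"
    using assms by (intro sum.cong refl) (auto simp: of_bool_def if_distrib[of "\<lambda>x. _ * x"] cong: if_cong)
  also have "\<dots> = 2 ^ n * X r c"
    using assms by (simp add: mult.commute)
  finally show ?thesis by simp
qed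

lemma pauli_string_orthonormal:
  assumes "P \<in> pauli_index n" "Q \<in> pauli_index n"
  shows "frob_inner (2 ^ n) (pauli_string n P) (pauli_string n Q) = 2 ^ n * of_bool (P = Q)"
proof -
  have site: "(\<Sum>a<2. \<Sum>b<2. cnj (pauli i a b) * pauli k a b) = 2 * of_bool (i = k)" if "i < 4" "k < 4" for i k
  proof -
    have "i \<in> {0,1,2,3}" "k \<in> {0,1,2,3}" using that by auto
    then show ?thesis by (auto simp: sum_lessThan_2 pauli_def)
  qed
  have "frob_inner (2 ^ n) (pauli_string n P) (pauli_string n Q)
    = (\<Sum>r<2^n. \<Sum>c<2^n. \<Prod>j = 1..n. cnj (pauli (P j) (site_bit n j r) (site_bit n j c))
          * pauli (Q j) (site_bit n j r) (site_bit n j c))"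
    unfolding frob_inner_def pauli_string_def by (simp add: prod.distrib)
  also have "\<dots> = (\<Prod>j = 1..n. \<Sum>a<2. \<Sum>b<2. cnj (pauli (P j) a b) * pauli (Q j) a b)"
    by (simp only: sum_prod_site_bit[where h="\<lambda>j b. cnj (pauli (P j) (site_bit n j r) b) * pauli (Q j) (site_bit n j r) b" for r]
        sum_prod_site_bit[where h="\<lambda>j a. \<Sum>b<2. cnj (pauli (P j) a b) * pauli (Q j) a b"])
  also have "\<dots> = (\<Prod>j = 1..n. 2 * of_bool (P j = Q j))"
    using assms by (simp add: site pauli_index_def)
  also have "\<dots> = 2 ^ n * of_bool (P = Q)"
  proof (cases "P = Q")
    case True
    then show ?thesis by simp
  next
    case False
    then obtain j where "P j \<noteq> Q j" by blast
    moreover from this have "j \<in> {1..n}"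
      using assms unfolding pauli_index_def mem_Collect_eq by metis
    ultimately have "\<exists>j\<in>{1..n}. P j \<noteq> Q j" by blast
    then have "(\<Prod>j = 1..n. 2 * of_bool (P j = Q j)) = (0::complex)"
      by (intro prod_zero) auto
    then show ?thesis using False by simp
  qed
  finally show ?thesis .
qed

lemma frob_inner_sum1: "frob_inner N (\<lambda>r c. \<Sum>i\<in>I. f i r c) Y = (\<Sum>i\<in>I. frob_inner N (f i) Y)"
  and frob_inner_sum2: "frob_inner N Y (\<lambda>r c. \<Sum>i\<in>I. f i r c) = (\<Sum>i\<in>I. frob_inner N Y (f i))"
proof -
  have swap: "(\<Sum>r<N. \<Sum>c<N. \<Sum>i\<in>I. g r c i) = (\<Sum>i\<in>I. \<Sum>r<N. \<Sum>c<N. g r c i)" for g :: "nat \<Rightarrow> nat \<Rightarrow> _ \<Rightarrow> complex"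
    by (subst sum.swap[of _ I], intro sum.cong refl sum.swap)
  show "frob_inner N (\<lambda>r c. \<Sum>i\<in>I. f i r c) Y = (\<Sum>i\<in>I. frob_inner N (f i) Y)"
    by (simp add: frob_inner_def sum_distrib_right swap)
  show "frob_inner N Y (\<lambda>r c. \<Sum>i\<in>I. f i r c) = (\<Sum>i\<in>I. frob_inner N Y (f i))"
    by (simp add: frob_inner_def sum_distrib_left swap)
qed

lemma frob_inner_scale: "frob_inner N (\<lambda>r c. k * X r c) Y = cnj k * frob_inner N X Y" "frob_inner N X (\<lambda>r c. k * Y r c) = k * frob_inner N X Y"
  by (simp_all add: frob_inner_def sum_distrib_left mult_ac)

lemma frob_inner_pauli_comb:
  "frob_inner (2 ^ n) (pauli_comb n x) (pauli_comb n y) = 2 ^ n * (\<Sum>P\<in>pauli_index n. cnj (x P) * y P)"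
proof -
  have "frob_inner (2 ^ n) (pauli_comb n x) (pauli_comb n y)
      = (\<Sum>P\<in>pauli_index n. \<Sum>Q\<in>pauli_index n. cnj (x P) * y Q * frob_inner (2 ^ n) (pauli_string n P) (pauli_string n Q))"
    unfolding pauli_comb_def by (simp add: frob_inner_sum1 frob_inner_sum2 frob_inner_scale sum_distrib_left mult_ac)
  also have "\<dots> = (\<Sum>P\<in>pauli_index n. \<Sum>Q\<in>pauli_index n. if P = Q then 2 ^ n * (cnj (x P) * y Q) else 0)"
    by (intro sum.cong refl) (simp add: pauli_string_orthonormal)
  also have "\<dots> = 2 ^ n * (\<Sum>P\<in>pauli_index n. cnj (x P) * y P)"
    by (simp add: finite_pauli_index sum_distrib_left)
  finally show ?thesis .
qed

lemma frob_sq_pauli_comb: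
  "frob_sq (2 ^ n) (pauli_comb n x) = 2 ^ n * (\<Sum>P\<in>pauli_index n. (cmod (x P))\<^sup>2)"
proof -
  have "of_real (frob_sq (2 ^ n) (pauli_comb n x)) = (of_real (2 ^ n * (\<Sum>P\<in>pauli_index n. (cmod (x P))\<^sup>2)) :: complex)"
    unfolding frob_inner_self[symmetric] frob_inner_pauli_comb of_real_mult of_real_sum complex_norm_square by (simp add: mult.commute)
  then show ?thesis by (simp only: of_real_eq_iff)
qed

lemma frob_inner_cong:
  assumes "\<And>r c. r < N \<Longrightarrow> c < N \<Longrightarrow> X r c = X' r c" "\<And>r c. r < N \<Longrightarrow> c < N \<Longrightarrow> Y r c = Y' r c"
  shows "frob_inner N X Y = frob_inner N X' Y'"
  using assms unfolding frob_inner_def by (intro sum.cong refl) simp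

lemma frob_sq_cong:
  assumes "\<And>r c. r < N \<Longrightarrow> c < N \<Longrightarrow> X r c = X' r c"
  shows "frob_sq N X = frob_sq N X'"
  using assms unfolding frob_sq_def by (intro sum.cong refl) simp

lemma tr4_pauli_string:
  "tr4 (2 ^ n) (pauli_string n P) (pauli_string n Q) (pauli_string n R) (pauli_string n S)
    = (\<Prod>j = 1..n. tr4 2 (pauli (P j)) (pauli (Q j)) (pauli (R j)) (pauli (S j)))"
proof -
  define h where "h = (\<lambda>j a c b d. cnj (pauli (P j) b a) * pauli (Q j) b c * (cnj (pauli (R j) d c) * pauli (S j) d a))"
  have tr4_eq: "tr4 N X Y Z W = (\<Sum>a<N. \<Sum>c<N. \<Sum>b<N. \<Sum>d<N. cnj (X b a) * Y b c * (cnj (Z d c) * W d a))" for N X Y Z W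
    by (simp add: tr4_def adj_mult_def sum_product)
  have "tr4 (2 ^ n) (pauli_string n P) (pauli_string n Q) (pauli_string n R) (pauli_string n S)
    = (\<Sum>a<2^n. \<Sum>c<2^n. \<Sum>b<2^n. \<Sum>d<2^n. \<Prod>j = 1..n.
        h j (site_bit n j a) (site_bit n j c) (site_bit n j b) (site_bit n j d))"
    unfolding tr4_eq pauli_string_def h_def by (simp add: prod.distrib)
  also have "\<dots> = (\<Prod>j = 1..n. \<Sum>a<2. \<Sum>c<2. \<Sum>b<2. \<Sum>d<2. h j a c b d)"
    by (simp only: sum_prod_site_bit[where h="\<lambda>j d. h j (site_bit n j a) (site_bit n j c) (site_bit n j b) d" for a b c]
        sum_prod_site_bit[where h="\<lambda>j b. \<Sum>d<2. h j (site_bit n j a) (site_bit n j c) b d" for a c]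
        sum_prod_site_bit[where h="\<lambda>j c. \<Sum>b<2. \<Sum>d<2. h j (site_bit n j a) c b d" for a]
        sum_prod_site_bit[where h="\<lambda>j a. \<Sum>c<2. \<Sum>b<2. \<Sum>d<2. h j a c b d"])
  finally show ?thesis by (simp add: h_def tr4_eq)
qed

section \<open>Hypercontractivity\<close>

definition damped_comb :: "nat \<Rightarrow> nat \<Rightarrow> real \<Rightarrow> ((nat \<Rightarrow> nat) \<Rightarrow> complex) \<Rightarrow> nat \<Rightarrow> nat \<Rightarrow> complex" where
  "damped_comb n m \<rho> y r c = (\<Sum>P\<in>pauli_index m. of_real (\<rho> ^ weight P) * y P * pauli_string n P r c)"

text \<open>The operator on the first \<open>m\<close> sites tensored with \<open>pauli i\<close> on
  site \<open>Suc m\<close>. The damping counts the weight of \<open>P\<close> only; the factor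
  \<open>\<rho>\<close> owed for a non-identity at the new site is kept outside, so that layers with
  different \<open>i\<close> are comparable.\<close>

definition damped_layer :: "nat \<Rightarrow> nat \<Rightarrow> real \<Rightarrow> nat \<Rightarrow> ((nat \<Rightarrow> nat) \<Rightarrow> complex) \<Rightarrow> nat \<Rightarrow> nat \<Rightarrow> complex" where
  "damped_layer n m \<rho> i y r c =
    (\<Sum>P\<in>pauli_index m. of_real (\<rho> ^ weight P) * y P * pauli_string n (P(Suc m := i)) r c)"

lemma pauli_index_upd_0: "P \<in> pauli_index m \<Longrightarrow> P(Suc m := 0) = P"
  by (auto simp: pauli_index_def fun_eq_iff)

lemma damped_layer_0: "damped_layer n m \<rho> 0 y = damped_comb n m \<rho> y"
  unfolding damped_layer_def damped_comb_def by (intro ext sum.cong refl) (simp add: pauli_index_upd_0)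

lemma damped_comb_Suc:
  "damped_comb n (Suc m) \<rho> y r c = damped_layer n m \<rho> 0 (\<lambda>P. y (P(Suc m := 0))) r c
    + of_real \<rho> * (damped_layer n m \<rho> 1 (\<lambda>P. y (P(Suc m := 1))) r c
      + damped_layer n m \<rho> 2 (\<lambda>P. y (P(Suc m := 2))) r c
      + damped_layer n m \<rho> 3 (\<lambda>P. y (P(Suc m := 3))) r c)"
proof -
  have "damped_comb n (Suc m) \<rho> y r c = (\<Sum>P\<in>pauli_index m. \<Sum>i<4.
      of_real (\<rho> ^ (weight P + of_bool (i \<noteq> 0))) * y (P(Suc m := i)) * pauli_string n (P(Suc m := i)) r c)"
    unfolding damped_comb_def sum_pauli_index_Suc by (intro sum.cong refl) (simp add: weight_upd)
  then show ?thesis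
    by (simp add: damped_layer_def sum_lessThan_4 sum.distrib sum_distrib_left algebra_simps)
qed

text \<open>The trace factorises over sites, and site \<open>Suc m\<close> contributes one factor common to all terms.\<close>

lemma tr4_damped_layer:
  assumes "m < n"
  shows "\<exists>G. \<forall>i k l q. tr4 (2 ^ n) (damped_layer n m \<rho> i x) (damped_layer n m \<rho> k y)
      (damped_layer n m \<rho> l z) (damped_layer n m \<rho> q w)
    = G * tr4 2 (pauli i) (pauli k) (pauli l) (pauli q)"
proof (intro exI allI)
  fix i k l q
  let ?I = "pauli_index m"
  let ?c = "\<lambda>y P. of_real (\<rho> ^ weight P) * (y P :: complex)"
  let ?g = "\<lambda>P Q R S. \<Prod>j\<in>{1..n} - {Suc m}. tr4 2 (pauli (P j)) (pauli (Q j)) (pauli (R j)) (pauli (S j))"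
  let ?G = "\<Sum>P\<in>?I. \<Sum>Q\<in>?I. \<Sum>R\<in>?I. \<Sum>S\<in>?I. cnj (?c x P) * (?c y Q * (cnj (?c z R) * (?c w S * ?g P Q R S)))"
  have string: "tr4 (2 ^ n) (pauli_string n (P(Suc m := i))) (pauli_string n (Q(Suc m := k)))
        (pauli_string n (R(Suc m := l))) (pauli_string n (S(Suc m := q)))
      = ?g P Q R S * tr4 2 (pauli i) (pauli k) (pauli l) (pauli q)" for P Q R S
  proof -
    have "(\<Prod>j\<in>{1..n} - {Suc m}. tr4 2 (pauli ((P(Suc m := i)) j)) (pauli ((Q(Suc m := k)) j))
        (pauli ((R(Suc m := l)) j)) (pauli ((S(Suc m := q)) j))) = ?g P Q R S"
      by (intro prod.cong) auto
    then show ?thesis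
      unfolding tr4_pauli_string using assms
      by (subst prod.remove[of _ "Suc m"]) (auto simp: mult.commute)
  qed
  show "tr4 (2 ^ n) (damped_layer n m \<rho> i x) (damped_layer n m \<rho> k y)
      (damped_layer n m \<rho> l z) (damped_layer n m \<rho> q w)
    = ?G * tr4 2 (pauli i) (pauli k) (pauli l) (pauli q)"
    unfolding damped_layer_def[abs_def] tr4_sum[OF finite_pauli_index] tr4_scale string
    by (simp only: sum_distrib_right mult.assoc)
qed

lemma tr4_damped_layer_eq_0:
  assumes "m < n" "tr4 2 (pauli i) (pauli k) (pauli l) (pauli q) = 0"
  shows "tr4 (2 ^ n) (damped_layer n m \<rho> i x) (damped_layer n m \<rho> k y)
      (damped_layer n m \<rho> l z) (damped_layer n m \<rho> q w) = 0"
  using tr4_damped_layer[OF assms(1), of \<rho> x y z w] assms(2) by auto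

text \<open>With the identity in three slots the trace is that of a single traceless matrix. This is
  what removes the first order terms in the inductive step of the Bonami lemma.\<close>

lemma tr4_pauli_vanish:
  assumes "i \<in> {1, 2, 3}"
  shows "tr4 2 (pauli i) (pauli 0) (pauli 0) (pauli 0) = 0" "tr4 2 (pauli 0) (pauli i) (pauli 0) (pauli 0) = 0"
    "tr4 2 (pauli 0) (pauli 0) (pauli i) (pauli 0) = 0" "tr4 2 (pauli 0) (pauli 0) (pauli 0) (pauli i) = 0"
  using assms by (auto simp: tr4_def adj_mult_def pauli_def sum_lessThan_2)

lemma tr4_pauli_self: "tr4 2 (pauli i) (pauli i) (pauli i) (pauli i) = 2"
  by (auto simp: tr4_def adj_mult_def pauli_def sum_lessThan_2)

text \<open>Tensoring with a unitary preserves the 4-norm. In the factorised trace all layers share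
  the same \<open>G\<close>, and the one-site factor is 2 for every \<open>i\<close>.\<close>

lemma norm4_damped_layer:
  assumes "m < n"
  shows "norm4 (2 ^ n) (damped_layer n m \<rho> i y) = norm4 (2 ^ n) (damped_comb n m \<rho> y)"
proof -
  from tr4_damped_layer[OF assms, of \<rho> y y y y] obtain G where
    G: "\<forall>i k l q. tr4 (2 ^ n) (damped_layer n m \<rho> i y) (damped_layer n m \<rho> k y)
      (damped_layer n m \<rho> l y) (damped_layer n m \<rho> q y)
    = G * tr4 2 (pauli i) (pauli k) (pauli l) (pauli q)"
    by (elim exE)
  have "of_real (norm4 (2 ^ n) (damped_layer n m \<rho> i y) ^ 4)
      = (of_real (norm4 (2 ^ n) (damped_layer n m \<rho> 0 y) ^ 4) :: complex)"
    unfolding tr4_self[symmetric] by (simp only: G[rule_format] tr4_pauli_self)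
  then have "norm4 (2 ^ n) (damped_layer n m \<rho> i y) ^ 4 = norm4 (2 ^ n) (damped_layer n m \<rho> 0 y) ^ 4"
    by (simp only: of_real_eq_iff)
  then show ?thesis
    by (simp add: norm4_nonneg power_eq_iff_eq_base damped_layer_0)
qed

lemma sum3_sq_le: "(x + y + z)\<^sup>2 \<le> 3 * (x\<^sup>2 + y\<^sup>2 + z\<^sup>2)" for x y z :: real
  using sum_squares_bound[of x y] sum_squares_bound[of y z] sum_squares_bound[of x z]
  by (simp add: power2_eq_square algebra_simps)

text \<open>The Bonami lemma, by induction on the number of active sites. The factor
  \<open>sqrt (2 ^ n)\<close> converts the unnormalised \<open>norm4\<close> and comes from the
  fourth power norm \<open>2 ^ n\<close> of the identity. In the step the operator splits into the
  layer with the identity at the new site and a perturbation \<open>Z\<close> with no first order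
  contribution.\<close>

lemma pauli_hypercontractivity:
  assumes "\<rho>\<^sup>2 = 1 / 12" "\<rho> \<ge> 0" "m \<le> n"
  shows "(norm4 (2 ^ n) (damped_comb n m \<rho> y))\<^sup>2 \<le> sqrt (2 ^ n) * (\<Sum>P\<in>pauli_index m. (cmod (y P))\<^sup>2)"
  using assms(3)
proof (induction m arbitrary: y)
  case 0
  have "weight (\<lambda>_. 0) = 0" by (simp add: weight_def)
  then have "damped_comb n 0 \<rho> y = (\<lambda>r c. y (\<lambda>_. 0) * pauli_string n (\<lambda>_. 0) r c)"
    by (simp add: damped_comb_def[abs_def] pauli_index_0)
  moreover have "norm4 (2 ^ n) (pauli_string n (\<lambda>_. 0)) ^ 4 = 2 ^ n"
  proof -
    have "of_real (norm4 (2 ^ n) (pauli_string n (\<lambda>_. 0)) ^ 4) = (of_real (2 ^ n) :: complex)"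
      unfolding tr4_self[symmetric] tr4_pauli_string tr4_pauli_self by simp
    then show ?thesis by (simp only: of_real_eq_iff)
  qed
  then have "((norm4 (2 ^ n) (pauli_string n (\<lambda>_. 0)))\<^sup>2)\<^sup>2 = 2 ^ n" by simp
  then have "sqrt (2 ^ n) = (norm4 (2 ^ n) (pauli_string n (\<lambda>_. 0)))\<^sup>2"
    by (rule real_sqrt_unique) simp
  ultimately show ?case
    by (simp add: norm4_scale power_mult_distrib pauli_index_0)
next
  case (Suc m)
  then have mn: "m < n" by simp
  define Y where "Y i = (\<lambda>P. y (P(Suc m := i)))" for i
  define L where "L i = damped_layer n m \<rho> i (Y i)" for i
  define Z where "Z = (\<lambda>r c. of_real \<rho> * (L 1 r c + L 2 r c + L 3 r c))"
  define s where "s i = (\<Sum>P\<in>pauli_index m. (cmod (Y i P))\<^sup>2)" for i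
  define z where "z i = norm4 (2 ^ n) (L i)" for i
  have z: "(z i)\<^sup>2 \<le> sqrt (2 ^ n) * s i" for i
    unfolding z_def L_def s_def norm4_damped_layer[OF mn] using Suc by simp
  have split: "damped_comb n (Suc m) \<rho> y = (\<lambda>r c. L 0 r c + Z r c)"
    unfolding L_def Z_def Y_def by (intro ext) (rule damped_comb_Suc)
  have van: "tr4 (2 ^ n) (L i) (L 0) (L 0) (L 0) = 0" "tr4 (2 ^ n) (L 0) (L i) (L 0) (L 0) = 0"
    "tr4 (2 ^ n) (L 0) (L 0) (L i) (L 0) = 0" "tr4 (2 ^ n) (L 0) (L 0) (L 0) (L i) = 0"
    if "i \<in> {1, 2, 3}" for i
    unfolding L_def by (intro tr4_damped_layer_eq_0[OF mn] tr4_pauli_vanish that)+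
  have "norm4 (2 ^ n) (damped_comb n (Suc m) \<rho> y) ^ 4
      \<le> norm4 (2 ^ n) (L 0) ^ 4 + 8 * (norm4 (2 ^ n) (L 0))\<^sup>2 * (norm4 (2 ^ n) Z)\<^sup>2 + 3 * norm4 (2 ^ n) Z ^ 4"
    unfolding split
    by (rule norm4_add_le) (simp_all add: Z_def tr4_scale tr4_add van)
  also have "\<dots> = ((z 0)\<^sup>2)\<^sup>2 + 8 * (z 0)\<^sup>2 * (norm4 (2 ^ n) Z)\<^sup>2 + 3 * ((norm4 (2 ^ n) Z)\<^sup>2)\<^sup>2"
    by (simp add: z_def)
  also have "\<dots> \<le> ((z 0)\<^sup>2)\<^sup>2 + 8 * (z 0)\<^sup>2 * (((z 1)\<^sup>2 + (z 2)\<^sup>2 + (z 3)\<^sup>2) / 4)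
      + 3 * (((z 1)\<^sup>2 + (z 2)\<^sup>2 + (z 3)\<^sup>2) / 4)\<^sup>2"
  proof -
    have "norm4 (2 ^ n) Z = \<rho> * norm4 (2 ^ n) (\<lambda>r c. L 1 r c + L 2 r c + L 3 r c)"
      unfolding Z_def norm4_scale using assms by simp
    also have "\<dots> \<le> \<rho> * (z 1 + z 2 + z 3)"
      unfolding z_def using assms(2)
      by (intro mult_left_mono order_trans[OF norm4_add] add_right_mono norm4_add) auto
    finally have "(norm4 (2 ^ n) Z)\<^sup>2 \<le> (\<rho> * (z 1 + z 2 + z 3))\<^sup>2"
      by (intro power_mono norm4_nonneg)
    \<comment> \<open>Cauchy-Schwarz over the three nontrivial Paulis costs a factor 3, and
      \<open>3 * \<rho>\<^sup>2 = 1 / 4\<close>.\<close>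
    also have "\<dots> \<le> ((z 1)\<^sup>2 + (z 2)\<^sup>2 + (z 3)\<^sup>2) / 4"
      using sum3_sq_le[of "z 1" "z 2" "z 3"] by (simp add: power_mult_distrib assms(1))
    finally have "(norm4 (2 ^ n) Z)\<^sup>2 \<le> ((z 1)\<^sup>2 + (z 2)\<^sup>2 + (z 3)\<^sup>2) / 4" .
    then show ?thesis
      by (intro add_mono mult_left_mono power_mono order_refl) simp_all
  qed
  \<comment> \<open>The mixed coefficient \<open>8 / 4 = 2\<close> is exactly that of the square on
    the right; this is the origin of \<open>\<rho>\<^sup>2 = 1 / 12\<close>. The last coefficient
    \<open>3 / 16\<close> is below 1.\<close>
  also have "\<dots> \<le> ((z 0)\<^sup>2 + ((z 1)\<^sup>2 + (z 2)\<^sup>2 + (z 3)\<^sup>2))\<^sup>2"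
    unfolding power2_sum[of "(z 0)\<^sup>2"] by (simp add: power_divide)
  finally have "((norm4 (2 ^ n) (damped_comb n (Suc m) \<rho> y))\<^sup>2)\<^sup>2 \<le> ((z 0)\<^sup>2 + ((z 1)\<^sup>2 + (z 2)\<^sup>2 + (z 3)\<^sup>2))\<^sup>2"
    by simp
  then have "(norm4 (2 ^ n) (damped_comb n (Suc m) \<rho> y))\<^sup>2 \<le> (z 0)\<^sup>2 + ((z 1)\<^sup>2 + (z 2)\<^sup>2 + (z 3)\<^sup>2)"
    by (rule power2_le_imp_le) simp
  also have "\<dots> \<le> sqrt (2 ^ n) * (s 0 + s 1 + s 2 + s 3)"
    using z[of 0] z[of 1] z[of 2] z[of 3] by (simp add: algebra_simps)
  also have "s 0 + s 1 + s 2 + s 3 = (\<Sum>P\<in>pauli_index (Suc m). (cmod (y P))\<^sup>2)"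
    by (simp add: s_def Y_def sum_pauli_index_Suc sum_lessThan_4 sum.distrib)
  finally show ?case .
qed

section \<open>Trace norm duality and the operators \<open>d_site\<close>\<close>

lemma vec_l2_nonneg: "vec_l2 N v \<ge> 0"
  by (simp add: vec_l2_def)

lemma vec_l2_sq: "(vec_l2 N v)\<^sup>2 = (\<Sum>r<N. (cmod (v r))\<^sup>2)"
  by (simp add: vec_l2_def L2_set_def sum_nonneg)

text \<open>The trace of \<open>X\<^sup>* Y\<close> computed in the family \<open>u\<close> instead
  of the standard basis. It allows both operators to be tested on the right singular vectors of one
  of them.\<close>

lemma frob_inner_resolution:
  assumes res: "resolves_identity N u"
  shows "frob_inner N X Y = (\<Sum>i<N. \<Sum>r<N. cnj (apply_vec N X (u i) r) * apply_vec N Y (u i) r)"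
proof -
  have "(\<Sum>i<N. \<Sum>r<N. cnj (apply_vec N X (u i) r) * apply_vec N Y (u i) r)
    = (\<Sum>i<N. \<Sum>r<N. \<Sum>c<N. \<Sum>d<N. cnj (X r c) * Y r d * (u i d * cnj (u i c)))"
    by (simp only: apply_vec_def cnj_sum complex_cnj_mult sum_product) (simp only: mult_ac)
  also have "\<dots> = (\<Sum>r<N. \<Sum>i<N. \<Sum>c<N. \<Sum>d<N. cnj (X r c) * Y r d * (u i d * cnj (u i c)))"
    by (rule sum.swap)
  also have "\<dots> = (\<Sum>r<N. \<Sum>c<N. \<Sum>i<N. \<Sum>d<N. cnj (X r c) * Y r d * (u i d * cnj (u i c)))"
    by (intro sum.cong refl sum.swap)
  also have "\<dots> = (\<Sum>r<N. \<Sum>c<N. \<Sum>d<N. \<Sum>i<N. cnj (X r c) * Y r d * (u i d * cnj (u i c)))"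
    by (intro sum.cong refl sum.swap)
  also have "\<dots> = (\<Sum>r<N. \<Sum>c<N. \<Sum>d<N. if d = c then cnj (X r c) * Y r d else 0)"
    unfolding sum_distrib_left[symmetric] using res
    by (intro sum.cong refl) (auto simp: resolves_identity_def)
  also have "\<dots> = frob_inner N X Y"
    by (simp add: frob_inner_def)
  finally show ?thesis ..
qed

lemma frob_sq_resolution:
  assumes "resolves_identity N u"
  shows "frob_sq N X = (\<Sum>i<N. (vec_l2 N (apply_vec N X (u i)))\<^sup>2)"
proof -
  have "of_real (frob_sq N X) = (of_real (\<Sum>i<N. (vec_l2 N (apply_vec N X (u i)))\<^sup>2) :: complex)"
    unfolding frob_inner_self[symmetric] frob_inner_resolution[OF assms] vec_l2_sq of_real_sum complex_norm_square
    by (simp only: mult.commute)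
  then show ?thesis by (simp only: of_real_eq_iff)
qed

text \<open>The left side is the quadratic form of \<open>Y\<^sup>* Y\<close> at the unit vector
  \<open>v\<close>, so Cauchy-Schwarz applies. Summed in squares over a resolution of the identity,
  the right side becomes the fourth power of the 4-norm.\<close>

lemma vec_l2_apply_vec_sq_le:
  assumes "vec_l2 N v = 1"
  shows "(vec_l2 N (apply_vec N Y v))\<^sup>2 \<le> vec_l2 N (apply_vec N (adj_mult N Y Y) v)"
proof -
  have "of_real ((vec_l2 N (apply_vec N Y v))\<^sup>2) = (\<Sum>r<N. apply_vec N Y v r * cnj (apply_vec N Y v r))"
    unfolding vec_l2_sq of_real_sum complex_norm_square ..
  also have "\<dots> = (\<Sum>r<N. \<Sum>a<N. \<Sum>c<N. cnj (v a) * (cnj (Y r a) * Y r c * v c))"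
    by (subst mult.commute, simp only: apply_vec_def cnj_sum complex_cnj_mult sum_product) (simp only: mult_ac)
  also have "\<dots> = (\<Sum>a<N. \<Sum>r<N. \<Sum>c<N. cnj (v a) * (cnj (Y r a) * Y r c * v c))"
    by (rule sum.swap)
  also have "\<dots> = (\<Sum>a<N. \<Sum>c<N. \<Sum>r<N. cnj (v a) * (cnj (Y r a) * Y r c * v c))"
    by (intro sum.cong refl sum.swap)
  also have "\<dots> = (\<Sum>a<N. cnj (v a) * apply_vec N (adj_mult N Y Y) v a)"
    by (simp add: apply_vec_def adj_mult_def sum_distrib_left sum_distrib_right)
  finally have "(vec_l2 N (apply_vec N Y v))\<^sup>2 = cmod (\<Sum>a<N. cnj (v a) * apply_vec N (adj_mult N Y Y) v a)"
    by (metis abs_power2 norm_of_real)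
  also have "\<dots> \<le> L2_set (\<lambda>a. cmod (cnj (v a))) {..<N} * vec_l2 N (apply_vec N (adj_mult N Y Y) v)"
    unfolding vec_l2_def by (rule norm_sum_mult_le_L2_set)
  finally show ?thesis using assms by (simp add: vec_l2_def)
qed

text \<open>Cauchy--Schwarz twice in an eigenbasis of \<open>X\<^sup>* X\<close>; no polar decomposition is needed.\<close>

lemma frob_inner_trace_norm_duality:
  assumes res: "resolves_identity N u"
    and unit: "\<And>i. i < N \<Longrightarrow> vec_l2 N (u i) = 1"
    and s: "\<And>i. i < N \<Longrightarrow> vec_l2 N (apply_vec N X (u i)) = s i"
  shows "(cmod (frob_inner N X Y))\<^sup>2 \<le> (\<Sum>i<N. s i) * sqrt (frob_sq N X) * (norm4 N Y)\<^sup>2"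
proof -
  define y where "y i = vec_l2 N (apply_vec N Y (u i))" for i
  have y: "y i \<ge> 0" for i by (simp add: y_def vec_l2_nonneg)
  have s0: "s i \<ge> 0" if "i < N" for i using s[OF that] vec_l2_nonneg by metis
  have "cmod (frob_inner N X Y) \<le> (\<Sum>i<N. cmod (\<Sum>r<N. cnj (apply_vec N X (u i) r) * apply_vec N Y (u i) r))"
    unfolding frob_inner_resolution[OF res] by (rule norm_sum)
  also have "\<dots> \<le> (\<Sum>i<N. s i * y i)"
  proof (intro sum_mono)
    fix i assume "i \<in> {..<N}"
    then show "cmod (\<Sum>r<N. cnj (apply_vec N X (u i) r) * apply_vec N Y (u i) r) \<le> s i * y i"
      using norm_sum_mult_le_L2_set[of "\<lambda>r. cnj (apply_vec N X (u i) r)" "apply_vec N Y (u i)" "{..<N}"] s[of i]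
      by (simp add: y_def vec_l2_def)
  qed
  \<comment> \<open>Splitting off one square root of \<open>s i\<close> isolates the trace norm; the
    remaining sum of \<open>s i * (y i)\<^sup>2\<close> is left for the second
    Cauchy-Schwarz.\<close>
  also have "\<dots> = (\<Sum>i<N. \<bar>sqrt (s i)\<bar> * \<bar>sqrt (s i) * y i\<bar>)"
    using s0 y by (intro sum.cong refl) (simp add: abs_mult mult.assoc[symmetric])
  also have "\<dots> \<le> L2_set (\<lambda>i. sqrt (s i)) {..<N} * L2_set (\<lambda>i. sqrt (s i) * y i) {..<N}"
    by (rule L2_set_mult_ineq)
  finally have "(cmod (frob_inner N X Y))\<^sup>2 \<le> (L2_set (\<lambda>i. sqrt (s i)) {..<N} * L2_set (\<lambda>i. sqrt (s i) * y i) {..<N})\<^sup>2"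
    by (intro power_mono) auto
  also have "\<dots> = (\<Sum>i<N. s i) * (\<Sum>i<N. s i * (y i)\<^sup>2)"
  proof -
    have "(\<Sum>i<N. s i) \<ge> 0" "(\<Sum>i<N. s i * (y i)\<^sup>2) \<ge> 0"
      using s0 by (auto intro!: sum_nonneg)
    moreover have "(\<Sum>i<N. (sqrt (s i))\<^sup>2) = (\<Sum>i<N. s i)"
      "(\<Sum>i<N. (sqrt (s i) * y i)\<^sup>2) = (\<Sum>i<N. s i * (y i)\<^sup>2)"
      using s0 by (auto intro!: sum.cong simp: power_mult_distrib)
    ultimately show ?thesis by (simp add: power_mult_distrib L2_set_def)
  qed
  also have "\<dots> \<le> (\<Sum>i<N. s i) * (sqrt (frob_sq N X) * (norm4 N Y)\<^sup>2)"
  proof (rule mult_left_mono)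
    have "(\<Sum>i<N. s i * (y i)\<^sup>2) = (\<Sum>i<N. \<bar>s i\<bar> * \<bar>(y i)\<^sup>2\<bar>)"
      using s0 by (intro sum.cong refl) simp
    also have "\<dots> \<le> L2_set s {..<N} * L2_set (\<lambda>i. (y i)\<^sup>2) {..<N}"
      by (rule L2_set_mult_ineq)
    also have "\<dots> \<le> sqrt (frob_sq N X) * (norm4 N Y)\<^sup>2"
    proof (rule mult_mono)
      show "L2_set s {..<N} \<le> sqrt (frob_sq N X)"
        unfolding frob_sq_resolution[OF res] L2_set_def by (simp add: s)
      have "L2_set (\<lambda>i. (y i)\<^sup>2) {..<N} \<le> L2_set (\<lambda>i. vec_l2 N (apply_vec N (adj_mult N Y Y) (u i))) {..<N}"
        unfolding y_def by (intro L2_set_mono vec_l2_apply_vec_sq_le unit) auto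
      also have "\<dots> = (norm4 N Y)\<^sup>2"
        unfolding norm4_sq frob_sq_resolution[OF res] L2_set_def ..
      finally show "L2_set (\<lambda>i. (y i)\<^sup>2) {..<N} \<le> (norm4 N Y)\<^sup>2" .
    qed (auto simp: frob_sq_nonneg)
    finally show "(\<Sum>i<N. s i * (y i)\<^sup>2) \<le> sqrt (frob_sq N X) * (norm4 N Y)\<^sup>2" .
    show "(\<Sum>i<N. s i) \<ge> 0" using s0 by (intro sum_nonneg) auto
  qed
  finally show ?thesis by (simp add: mult.assoc)
qed

section \<open>The operator norm bound for \<open>d_site\<close>\<close>

lemma vec_l2_apply_vec_le: "vec_l2 N (apply_vec N X v) \<le> sqrt (frob_sq N X) * vec_l2 N v"
proof -
  have row: "cmod (apply_vec N X v r) \<le> L2_set (\<lambda>c. cmod (X r c)) {..<N} * vec_l2 N v" for r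
    unfolding apply_vec_def vec_l2_def by (rule norm_sum_mult_le_L2_set)
  have "(vec_l2 N (apply_vec N X v))\<^sup>2 \<le> (\<Sum>r<N. (L2_set (\<lambda>c. cmod (X r c)) {..<N} * vec_l2 N v)\<^sup>2)"
    by (subst vec_l2_sq, intro sum_mono power_mono row) auto
  also have "\<dots> = (sqrt (frob_sq N X) * vec_l2 N v)\<^sup>2"
    by (simp add: power_mult_distrib frob_sq_nonneg sum_distrib_right[symmetric]) (simp add: frob_sq_def L2_set_def sum_nonneg)
  finally show ?thesis by (rule power2_le_imp_le) (simp add: vec_l2_nonneg frob_sq_nonneg)
qed

lemma vec_l2_scale: "vec_l2 N (\<lambda>r. k * v r) = cmod k * vec_l2 N v"
proof -
  have "(vec_l2 N (\<lambda>r. k * v r))\<^sup>2 = (cmod k * vec_l2 N v)\<^sup>2"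
    unfolding power_mult_distrib vec_l2_sq by (simp add: norm_mult power_mult_distrib sum_distrib_left)
  then show ?thesis by (rule power2_eq_imp_eq) (simp_all add: vec_l2_nonneg)
qed

lemma vec_l2_add: "vec_l2 N (\<lambda>r. v r + w r) \<le> vec_l2 N v + vec_l2 N w"
proof -
  have "vec_l2 N (\<lambda>r. v r + w r) \<le> L2_set (\<lambda>r. cmod (v r) + cmod (w r)) {..<N}"
    unfolding vec_l2_def by (intro L2_set_mono norm_triangle_ineq) auto
  also have "\<dots> \<le> vec_l2 N v + vec_l2 N w"
    unfolding vec_l2_def by (rule L2_set_triangle_ineq)
  finally show ?thesis .
qed

definition contraction :: "nat \<Rightarrow> (nat \<Rightarrow> nat \<Rightarrow> complex) \<Rightarrow> bool" where
  "contraction N X \<longleftrightarrow> (\<forall>v. vec_l2 N (apply_vec N X v) \<le> vec_l2 N v)"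

text \<open>A real supremum bounds its set only if the set is bounded above, which the Frobenius
  norm guarantees here. Unit vectors give the claim in general by rescaling; a vector of length 0 is
  treated apart.\<close>

lemma contraction_entries:
  assumes A: "A \<in> carrier_mat N N" and op: "op_norm A \<le> 1"
  shows "contraction N (entries A)"
proof -
  have vn: "vec_norm2 w = vec_l2 N (($) w)" if "w \<in> carrier_vec N" for w
  proof -
    have "w \<bullet>c w = of_real (\<Sum>k<N. (cmod (w $ k))\<^sup>2)"
      unfolding of_real_sum complex_norm_square using that by (simp add: scalar_prod_def lessThan_atLeast0)
    then show ?thesis by (simp add: vec_norm2_def vec_l2_def L2_set_def)
  qed
  have app: "vec_l2 N (($) (A *\<^sub>v w)) = vec_l2 N (apply_vec N (entries A) (($) w))" if "w \<in> carrier_vec N" for w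
    unfolding vec_l2_def using that A
    by (intro L2_set_cong refl) (auto simp: apply_vec_def entries_def scalar_prod_def lessThan_atLeast0)
  let ?S = "{vec_norm2 (A *\<^sub>v v) | v. v \<in> carrier_vec (dim_col A) \<and> vec_norm2 v = 1}"
  have "bdd_above ?S"
  proof (rule bdd_aboveI)
    fix x assume "x \<in> ?S"
    then obtain v where v: "v \<in> carrier_vec N" "vec_norm2 v = 1" "x = vec_norm2 (A *\<^sub>v v)"
      using A by auto
    then show "x \<le> sqrt (frob_sq N (entries A))"
      using vn[OF v(1)] vn[of "A *\<^sub>v v"] A app[OF v(1)] vec_l2_apply_vec_le[of N "entries A" "($) v"] by simp
  qed
  then have unit: "vec_l2 N (apply_vec N (entries A) (($) w)) \<le> 1" if "w \<in> carrier_vec N" "vec_l2 N (($) w) = 1" for w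
  proof -
    have "vec_norm2 (A *\<^sub>v w) \<in> ?S" using that A vn[of w] by auto
    then have "vec_norm2 (A *\<^sub>v w) \<le> op_norm A"
      unfolding op_norm_def using \<open>bdd_above ?S\<close> by (rule cSup_upper)
    then show ?thesis using op vn[of "A *\<^sub>v w"] app[of w] that A by simp
  qed
  show ?thesis
    unfolding contraction_def
  proof
    fix v
    show "vec_l2 N (apply_vec N (entries A) v) \<le> vec_l2 N v"
    proof (cases "vec_l2 N v = 0")
      case True
      then show ?thesis using vec_l2_apply_vec_le[of N "entries A" v] by simp
    next
      case False
      define k where "k = complex_of_real (1 / vec_l2 N v)"
      have k: "cmod k = 1 / vec_l2 N v" unfolding k_def norm_of_real by (simp add: vec_l2_nonneg)
      define w where "w = vec N (\<lambda>c. k * v c)"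
      have w: "w \<in> carrier_vec N" by (simp add: w_def)
      have "vec_l2 N (($) w) = vec_l2 N (\<lambda>c. k * v c)"
        unfolding vec_l2_def w_def by (intro L2_set_cong) auto
      then have "vec_l2 N (($) w) = 1"
        using False by (simp add: vec_l2_scale k)
      from unit[OF w this] have "vec_l2 N (apply_vec N (entries A) (($) w)) \<le> 1" .
      also have "apply_vec N (entries A) (($) w) = (\<lambda>r. k * apply_vec N (entries A) v r)"
        by (intro ext) (simp add: apply_vec_def w_def sum_distrib_left mult_ac)
      finally show ?thesis using False vec_l2_nonneg[of N v] by (simp add: vec_l2_scale k divide_simps)
    qed
  qed
qed

text \<open>Both sides of \<open>X\<close> are multiplied by a permutation and a diagonal of
  unimodular entries, which are isometries. A bit flip \<open>\<pi>\<close> and a sign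
  \<open>\<epsilon>\<close> at one site realise conjugation by the Pauli matrices there.\<close>

lemma contraction_conj:
  assumes "contraction N X" "bij_betw \<pi> {..<N} {..<N}" "\<And>r. cmod (\<epsilon> r) = 1" "\<And>r. \<pi> (\<pi> r) = r"
  shows "contraction N (\<lambda>r c. \<epsilon> r * X (\<pi> r) (\<pi> c) * \<epsilon> c)"
  unfolding contraction_def
proof
  fix v
  define w where "w c = \<epsilon> (\<pi> c) * v (\<pi> c)" for c
  have perm: "vec_l2 N (\<lambda>r. f (\<pi> r)) = vec_l2 N f" for f
    unfolding vec_l2_def L2_set_def by (subst sum.reindex_bij_betw[OF assms(2), symmetric]) simp
  have unimod: "vec_l2 N (\<lambda>r. \<epsilon> r * f r) = vec_l2 N f" for f
    by (simp add: vec_l2_def norm_mult assms(3))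
  have "apply_vec N (\<lambda>r c. \<epsilon> r * X (\<pi> r) (\<pi> c) * \<epsilon> c) v r = \<epsilon> r * apply_vec N X w (\<pi> r)" for r
  proof -
    have "apply_vec N X w (\<pi> r) = (\<Sum>c<N. X (\<pi> r) (\<pi> c) * w (\<pi> c))"
      unfolding apply_vec_def by (rule sum.reindex_bij_betw[OF assms(2), symmetric])
    then show ?thesis by (simp add: apply_vec_def w_def assms(4) sum_distrib_left mult_ac)
  qed
  then have "vec_l2 N (apply_vec N (\<lambda>r c. \<epsilon> r * X (\<pi> r) (\<pi> c) * \<epsilon> c) v) = vec_l2 N (apply_vec N X w)"
    using unimod[of "\<lambda>r. apply_vec N X w (\<pi> r)"] perm[of "apply_vec N X w"] by presburger
  also have "\<dots> \<le> vec_l2 N w" using assms(1) by (simp add: contraction_def)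
  also have "vec_l2 N w = vec_l2 N v"
    unfolding w_def using perm[of "\<lambda>c. \<epsilon> c * v c"] unimod[of v] by simp
  finally show "vec_l2 N (apply_vec N (\<lambda>r c. \<epsilon> r * X (\<pi> r) (\<pi> c) * \<epsilon> c) v) \<le> vec_l2 N v" .
qed

lemma d_site_carrier: "d_site n j A \<in> carrier_mat (2 ^ n) (2 ^ n)"
  by (simp add: d_site_def site_map_def)

lemma d_site_entry:
  assumes "r < 2 ^ n" "c < 2 ^ n" "1 \<le> j" "j \<le> n"
  shows "entries (d_site n j A) r c = entries A r c - of_bool (site_bit n j r = site_bit n j c) *
    (entries A (site_put n j 0 r) (site_put n j 0 c) + entries A (site_put n j 1 r) (site_put n j 1 c)) / 2"
proof -
  have put: "site_put n j (site_bit n j x) x = x" for x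
    by (auto simp: site_put_def site_bit_def intro!: bit_eqI simp: bit_set_bit_iff bit_unset_bit_iff)
  show ?thesis
    using assms
    by (auto simp: entries_def d_site_def site_map_def site_block_def mat_trace_def sum_lessThan_2 site_bit_less put
        split: if_splits)
qed

text \<open>Averaging the conjugates of \<open>A\<close> by 1, Z, X, Y at site \<open>j\<close> (the
  operators \<open>K 0\<close> to \<open>K 3\<close>) replaces that factor by its half trace times
  the identity. Hence \<open>d_site n j A\<close> is \<open>A\<close> minus an average of
  contractions, and its norm is at most \<open>1 + 1\<close>.\<close>

lemma vec_l2_apply_vec_d_site_le:
  assumes A: "contraction (2 ^ n) (entries A)" and j: "1 \<le> j" "j \<le> n"
  shows "vec_l2 (2 ^ n) (apply_vec (2 ^ n) (entries (d_site n j A)) v) \<le> 2 * vec_l2 (2 ^ n) v"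
proof -
  let ?N = "2 ^ n :: nat"
  define \<pi> where "\<pi> = (\<lambda>r::nat. flip_bit (n - j) r)"
  define \<epsilon> where "\<epsilon> = (\<lambda>r. if site_bit n j r = 0 then 1 else - 1 :: complex)"
  have inv: "\<pi> (\<pi> r) = r" for r
    by (rule bit_eqI) (auto simp: \<pi>_def bit_flip_bit_iff)
  have lt: "\<pi> r < ?N" if "r < ?N" for r
  proof -
    have "\<not> n \<le> n - j" using j by linarith
    then have "take_bit n (\<pi> r) = \<pi> r"
      using that j by (simp add: \<pi>_def take_bit_flip_bit_eq take_bit_nat_eq_self)
    then show ?thesis by (simp add: take_bit_nat_eq_self_iff)
  qed
  have bij: "bij_betw \<pi> {..<?N} {..<?N}"
    by (rule bij_betwI[where g=\<pi>]) (auto simp: inv lt)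
  define K where "K = (\<lambda>i. if i = 0 then entries A else if i = (1::nat) then (\<lambda>r c. \<epsilon> r * entries A r c * \<epsilon> c)
    else if i = 2 then (\<lambda>r c. entries A (\<pi> r) (\<pi> c)) else (\<lambda>r c. \<epsilon> r * entries A (\<pi> r) (\<pi> c) * \<epsilon> c))"
  have \<epsilon>: "cmod (\<epsilon> r) = 1" for r by (simp add: \<epsilon>_def)
  have K: "contraction ?N (K i)" for i
    using A contraction_conj[OF A bij \<epsilon> inv] contraction_conj[OF A bij _ inv, of "\<lambda>_. 1"]
      contraction_conj[OF A bij_betw_id[unfolded id_def] \<epsilon>]
    by (simp add: K_def)
  have put: "site_put n j 0 r = (if site_bit n j r = 0 then r else \<pi> r)"
    "site_put n j 1 r = (if site_bit n j r = 0 then \<pi> r else r)" for r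
    by (auto simp: site_put_def site_bit_def \<pi>_def intro!: bit_eqI
        simp: bit_set_bit_iff bit_unset_bit_iff bit_flip_bit_iff)
  have entry: "entries (d_site n j A) r c = entries A r c + (- 1 / 4) * (K 0 r c + K 1 r c + K 2 r c + K 3 r c)"
    if "r < ?N" "c < ?N" for r c
  proof -
    have eq: "site_bit n j r = site_bit n j c \<longleftrightarrow> (site_bit n j r = 0 \<longleftrightarrow> site_bit n j c = 0)"
      by (auto simp: site_bit_def)
    show ?thesis
      unfolding d_site_entry[OF that j] eq put K_def \<epsilon>_def
      by (cases "site_bit n j r = 0"; cases "site_bit n j c = 0") (simp_all add: field_simps)
  qed
  let ?a = "\<lambda>X. apply_vec ?N X v"
  have app: "?a (entries (d_site n j A)) r
      = ?a (entries A) r + (- 1 / 4) * (?a (K 0) r + ?a (K 1) r + ?a (K 2) r + ?a (K 3) r)" if "r < ?N" for r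
    unfolding apply_vec_def sum.distrib[symmetric] sum_distrib_left
  proof (intro sum.cong refl)
    fix c assume "c \<in> {..<?N}"
    then have c: "c < ?N" by simp
    show "entries (d_site n j A) r c * v c = entries A r c * v c
        + (- 1 / 4) * (K 0 r c * v c + K 1 r c * v c + K 2 r c * v c + K 3 r c * v c)"
      unfolding entry[OF that c] by (simp only: algebra_simps)
  qed
  have "vec_l2 ?N (?a (entries (d_site n j A)))
      = vec_l2 ?N (\<lambda>r. ?a (entries A) r + (- 1 / 4) * (?a (K 0) r + ?a (K 1) r + ?a (K 2) r + ?a (K 3) r))"
    unfolding vec_l2_def by (intro L2_set_cong arg_cong[where f=cmod] refl app) simp
  also have "\<dots> \<le> vec_l2 ?N (?a (entries A)) + (1 / 4) * (vec_l2 ?N (?a (K 0)) + vec_l2 ?N (?a (K 1)) + vec_l2 ?N (?a (K 2)) + vec_l2 ?N (?a (K 3)))"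
    by (rule order_trans[OF vec_l2_add], rule add_left_mono, subst vec_l2_scale)
      (intro mult_mono order_trans[OF vec_l2_add] add_mono, auto simp: vec_l2_nonneg)
  also have "\<dots> \<le> vec_l2 ?N v + (1 / 4) * (vec_l2 ?N v + vec_l2 ?N v + vec_l2 ?N v + vec_l2 ?N v)"
    using A K by (intro add_mono mult_left_mono) (auto simp: contraction_def)
  finally show ?thesis by simp
qed

text \<open>In the Pauli basis \<open>d_site\<close> is a diagonal projection: at site
  \<open>j\<close> the identity coincides with its half trace part and is killed, while the other
  three matrices are traceless and survive. It suffices to check this on one string at a
  time.\<close>

lemma pauli_comb_d_site:
  assumes "r < 2 ^ n" "c < 2 ^ n" "1 \<le> j" "j \<le> n"
  shows "entries (d_site n j A) r c
    = pauli_comb n (\<lambda>P. if P j = 0 then 0 else pauli_coeff n (entries A) P) r c"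
proof -
  let ?c = "pauli_coeff n (entries A)"
  let ?b = "of_bool (site_bit n j r = site_bit n j c) :: complex"
  have string: "pauli_string n P r c - ?b * (pauli_string n P (site_put n j 0 r) (site_put n j 0 c)
      + pauli_string n P (site_put n j 1 r) (site_put n j 1 c)) / 2 = (if P j = 0 then 0 else pauli_string n P r c)" for P
  proof -
    define z where "z = (\<Prod>k\<in>{1..n} - {j}. pauli (P k) (site_bit n k r) (site_bit n k c))"
    have split: "pauli_string n P r' c' = pauli (P j) (site_bit n j r') (site_bit n j c')
        * (\<Prod>k\<in>{1..n} - {j}. pauli (P k) (site_bit n k r') (site_bit n k c'))" for r' c'
      unfolding pauli_string_def using assms by (intro prod.remove) auto
    have "pauli_string n P (site_put n j a r) (site_put n j a c) = pauli (P j) a a * z" if "a < 2" for a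
    proof -
      have "(\<Prod>k\<in>{1..n} - {j}. pauli (P k) (site_bit n k (site_put n j a r)) (site_bit n k (site_put n j a c))) = z"
        unfolding z_def using assms that by (intro prod.cong refl) (simp add: site_bit_put)
      then show ?thesis unfolding split using assms that by (simp add: site_bit_put)
    qed
    from this[of 0] this[of 1] have
      "pauli_string n P (site_put n j 0 r) (site_put n j 0 c) = pauli (P j) 0 0 * z"
      "pauli_string n P (site_put n j 1 r) (site_put n j 1 c) = pauli (P j) 1 1 * z"
      by (simp_all only: one_less_numeral_iff semiring_norm zero_less_numeral)
    moreover have "pauli_string n P r c = pauli (P j) (site_bit n j r) (site_bit n j c) * z"
      by (simp only: split z_def)
    ultimately show ?thesis
      by (simp only:) (auto simp: pauli_def)
  qed
  have "entries (d_site n j A) r c = pauli_comb n ?c r c - ?b * (pauli_comb n ?c (site_put n j 0 r) (site_put n j 0 c)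
      + pauli_comb n ?c (site_put n j 1 r) (site_put n j 1 c)) / 2"
    unfolding d_site_entry[OF assms] using assms by (simp add: pauli_expansion site_put_less)
  also have "\<dots> = (\<Sum>P\<in>pauli_index n. ?c P * (pauli_string n P r c
      - ?b * (pauli_string n P (site_put n j 0 r) (site_put n j 0 c)
      + pauli_string n P (site_put n j 1 r) (site_put n j 1 c)) / 2))"
    unfolding pauli_comb_def sum.distrib[symmetric] sum_distrib_left sum_divide_distrib sum_subtractf[symmetric]
    by (intro sum.cong refl) (simp add: algebra_simps)
  also have "\<dots> = pauli_comb n (\<lambda>P. if P j = 0 then 0 else ?c P) r c"
    unfolding string pauli_comb_def by (intro sum.cong) auto
  finally show ?thesis .
qed

section \<open>The variance inequality\<close>

text \<open>With \<open>L = ln (1 / a)\<close> and \<open>e = (2 - p) / 4\<close>, the excess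
  exponent \<open>(2 - p) / (2 * p)\<close> is at least \<open>e\<close> since \<open>p < 2\<close>,
  so the power of \<open>a\<close> equals \<open>a\<close> times a factor at most
  \<open>exp (- e * L)\<close>. The choice of \<open>m\<close> spends half of this decay:
  \<open>12 \<le> exp 3\<close> and \<open>m \<le> e * L / 6\<close> give
  \<open>12 ^ m \<le> exp (e * L / 2)\<close>. The other half is converted into
  \<open>1 / (1 + L)\<close> by \<open>1 + x \<le> exp x\<close>.\<close>

lemma level_split_numeric:
  fixes a p V :: real
  assumes a: "0 < a" "a < 1" and p: "1 \<le> p" "p < 2"
    and V: "\<And>m::nat. V \<le> 12 ^ m * 3 * a powr (1 / 2 + 1 / p) + 2 * a / (real m + 1)"
  shows "V \<le> 120 / (2 - p) * (a / (1 + ln (1 / a)))"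
proof -
  define L where "L = ln (1 / a)"
  define e where "e = (2 - p) / 4"
  have L: "L > 0" "L = - ln a" using a by (simp_all add: L_def ln_div)
  have e: "0 < e" "e \<le> 1 / 4" using p by (simp_all add: e_def)
  define m where "m = nat \<lfloor>e * L / 6\<rfloor>"
  have m: "real m \<le> e * L / 6" "e * L / 6 \<le> real m + 1"
  proof -
    have "e * L / 6 \<ge> 0" using L(1) e by simp
    then have "real m = of_int \<lfloor>e * L / 6\<rfloor>" by (simp only: m_def of_nat_nat zero_le_floor)
    then show "real m \<le> e * L / 6" "e * L / 6 \<le> real m + 1" by linarith+
  qed
  have "(12::real) \<le> exp 3"
  proof -
    have "(5 / 2) ^ 3 \<le> exp (1::real) ^ 3"
      using exp_lower_Taylor_quadratic[of 1] by (intro power_mono) auto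
    moreover have "(12::real) \<le> (5 / 2) ^ 3" by (simp add: power3_eq_cube)
    ultimately show ?thesis by (simp add: exp_of_nat_mult[symmetric])
  qed
  then have "(12::real) ^ m \<le> exp 3 ^ m" by (intro power_mono) auto
  also have "\<dots> = exp (3 * real m)" by (simp add: exp_of_nat_mult[symmetric] mult.commute)
  also have "\<dots> \<le> exp (e * L / 2)" using m(1) by simp
  finally have pow: "(12::real) ^ m \<le> exp (e * L / 2)" .
  have "a powr (1 / 2 + 1 / p) = a * a powr ((2 - p) / (2 * p))"
  proof -
    have "1 / 2 + 1 / p = 1 + (2 - p) / (2 * p)" using p by (simp add: field_simps)
    then show ?thesis using a by (simp only: powr_add) simp
  qed
  also have "\<dots> \<le> a * exp (- (e * L))"
  proof (rule mult_left_mono)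
    have "e \<le> (2 - p) / (2 * p)"
      unfolding e_def using p by (intro divide_left_mono) auto
    then have "a powr ((2 - p) / (2 * p)) \<le> a powr e"
      using a by (intro powr_mono') auto
    also have "\<dots> = exp (- (e * L))" using a by (simp add: powr_def L(2))
    finally show "a powr ((2 - p) / (2 * p)) \<le> exp (- (e * L))" .
  qed (use a in simp)
  finally have "12 ^ m * 3 * a powr (1 / 2 + 1 / p) \<le> exp (e * L / 2) * 3 * (a * exp (- (e * L)))"
    using pow a by (intro mult_mono) auto
  also have "\<dots> = 3 * a * (exp (e * L / 2) * exp (- (e * L)))" by simp
  also have "exp (e * L / 2) * exp (- (e * L)) = inverse (exp (e * L / 2))"
    unfolding exp_add[symmetric] exp_minus[symmetric] by (simp add: field_simps)
  also have "inverse (exp (e * L / 2)) \<le> inverse (e / 2 * (1 + L))"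
  proof (rule le_imp_inverse_le)
    have "e / 2 * (1 + L) \<le> 1 + e * L / 2" using e by (simp add: algebra_simps)
    also have "\<dots> \<le> exp (e * L / 2)" by (rule exp_ge_add_one_self)
    finally show "e / 2 * (1 + L) \<le> exp (e * L / 2)" .
    show "0 < e / 2 * (1 + L)" using e L by simp
  qed
  finally have first: "12 ^ m * 3 * a powr (1 / 2 + 1 / p) \<le> 3 * a * inverse (e / 2 * (1 + L))"
    using a by simp
  have "2 * a / (real m + 1) \<le> 2 * a / (e / 12 * (1 + L))"
  proof (rule divide_left_mono)
    have "e / 12 * (1 + L) = e / 12 + (e * L / 6) / 2" by (simp add: algebra_simps)
    also have "\<dots> \<le> real m + 1" using m(2) e by linarith
    finally show "e / 12 * (1 + L) \<le> real m + 1" .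
  qed (use a(1) e L(1) in \<open>auto intro!: mult_pos_pos\<close>)
  then have "V \<le> 3 * a * inverse (e / 2 * (1 + L)) + 2 * a / (e / 12 * (1 + L))"
    using V[of m] first by linarith
  \<comment> \<open>The low levels contribute \<open>6 / e\<close> and the high levels
    \<open>24 / e\<close>; together this is \<open>30 / e = 120 / (2 - p)\<close>.\<close>
  also have "\<dots> = 120 / (2 - p) * (a / (1 + L))"
    using e L p by (simp add: e_def field_simps)
  finally show ?thesis by (simp add: L_def)
qed

lemma schatten_powr_eq:
  assumes "schatten_norm n p X = (t / 2 ^ n) powr (1 / p)" "t \<ge> 0" "p > 0"
  shows "schatten_norm n p X powr p = t / 2 ^ n"
  using assms by (simp add: powr_powr)

lemma schatten_2_sq:
  assumes X: "X \<in> carrier_mat (2 ^ n) (2 ^ n)"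
  shows "(schatten_norm n 2 X)\<^sup>2 = frob_sq (2 ^ n) (entries X) / 2 ^ n"
proof -
  obtain u s where s: "\<forall>i. s i \<ge> 0" "\<forall>i<2 ^ n. vec_l2 (2 ^ n) (apply_vec (2 ^ n) (entries X) (u i)) = s i"
    "resolves_identity (2 ^ n) u"
    "\<forall>n' p. schatten_norm n' p X = ((\<Sum>i<2 ^ n. s i powr p) / 2 ^ n') powr (1 / p)"
    using singular_values_exist[OF X] by blast
  have "schatten_norm n 2 X powr 2 = (\<Sum>i<2 ^ n. s i powr 2) / 2 ^ n"
    using s(4) by (intro schatten_powr_eq) (auto intro!: sum_nonneg)
  moreover have "(\<Sum>i<2 ^ n. s i powr 2) = frob_sq (2 ^ n) (entries X)"
    unfolding frob_sq_resolution[OF s(3)] using s(1,2) by (intro sum.cong refl) (auto simp: powr_numeral)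
  ultimately show ?thesis by (simp add: schatten_norm_def)
qed

text \<open>Compared coefficient by coefficient: for weight at most \<open>m\<close> the damped term
  alone is at least 1, because \<open>12 ^ (m - weight P) \<ge> 1\<close>; for larger weight the
  second term dominates. The nonzero weight excludes the constant string.\<close>

lemma weighted_sum_bound:
  fixes x :: "(nat \<Rightarrow> nat) \<Rightarrow> complex"
  assumes "\<And>P. P \<in> I \<Longrightarrow> x P \<noteq> 0 \<Longrightarrow> weight P \<noteq> 0"
  shows "(\<Sum>P\<in>I. (cmod (x P))\<^sup>2 / weight P)
    \<le> 12 ^ m * (\<Sum>P\<in>I. (1 / 12) ^ weight P * (cmod (x P))\<^sup>2) + (\<Sum>P\<in>I. (cmod (x P))\<^sup>2) / (real m + 1)"
  unfolding sum_distrib_left sum_divide_distrib sum.distrib[symmetric]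
proof (rule sum_mono)
  fix P assume "P \<in> I"
  show "(cmod (x P))\<^sup>2 / weight P \<le> 12 ^ m * ((1 / 12) ^ weight P * (cmod (x P))\<^sup>2) + (cmod (x P))\<^sup>2 / (real m + 1)"
  proof (cases "x P = 0")
    case False
    then have w: "weight P \<ge> 1" using assms \<open>P \<in> I\<close> by fastforce
    have "1 / real (weight P) \<le> 12 ^ m * (1 / 12) ^ weight P + 1 / (real m + 1)"
    proof (cases "weight P \<le> m")
      case True
      have "1 / real (weight P) \<le> 1" using w by simp
      also have "(1::real) \<le> 12 ^ (m - weight P)" by simp
      also have "\<dots> = 12 ^ m * (1 / 12) ^ weight P" using True by (simp add: power_diff power_divide)
      finally show ?thesis by (simp add: add_increasing2)
    next
      case False
      then have "1 / real (weight P) \<le> 1 / (real m + 1)" using w by (intro divide_left_mono) auto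
      then show ?thesis by (simp add: add_increasing)
    qed
    from mult_right_mono[OF this, of "(cmod (x P))\<^sup>2"] show ?thesis by (simp add: algebra_simps)
  qed simp
qed

lemma weight_0_iff:
  assumes "P \<in> pauli_index n"
  shows "weight P = 0 \<longleftrightarrow> P = (\<lambda>_. 0)"
proof -
  have "weight P = 0 \<longleftrightarrow> (\<forall>j\<in>{1..n}. P j = 0)"
    unfolding weight_eq_sum[OF assms] by (subst sum_eq_0_iff) auto
  also have "\<dots> \<longleftrightarrow> P = (\<lambda>_. 0)"
    using assms unfolding pauli_index_def mem_Collect_eq fun_eq_iff by blast
  finally show ?thesis .
qed

text \<open>Pairing \<open>X\<close> with \<open>Y = T\<^sub>\<rho> (T\<^sub>\<rho> X)\<close>, where \<open>T\<^sub>\<rho>\<close> damps each Pauli string by \<open>\<rho> ^ weight P\<close>, gives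
  the damped energy \<open>D\<close>, while hypercontractivity bounds the squared 4-norm of \<open>Y\<close> by \<open>D\<close>. Duality then
  yields \<open>D\<^sup>2 \<le> \<parallel>X\<parallel>\<^sub>1 \<parallel>X\<parallel>\<^sub>2 D\<close>.\<close>

lemma damped_energy_bound:
  fixes x :: "(nat \<Rightarrow> nat) \<Rightarrow> complex"
  assumes ent: "\<And>r c. r < 2 ^ n \<Longrightarrow> c < 2 ^ n \<Longrightarrow> entries X r c = pauli_comb n x r c"
    and res: "resolves_identity (2 ^ n) u"
    and unit: "\<And>i. i < 2 ^ n \<Longrightarrow> vec_l2 (2 ^ n) (u i) = 1"
    and s: "\<And>i. i < 2 ^ n \<Longrightarrow> vec_l2 (2 ^ n) (apply_vec (2 ^ n) (entries X) (u i)) = s i"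
  shows "(\<Sum>P\<in>pauli_index n. (1 / 12) ^ weight P * (cmod (x P))\<^sup>2)
    \<le> (\<Sum>i<2 ^ n. s i) / 2 ^ n * sqrt (\<Sum>P\<in>pauli_index n. (cmod (x P))\<^sup>2)"
proof -
  define \<rho> :: real where "\<rho> = sqrt (1 / 12)"
  have \<rho>: "\<rho>\<^sup>2 = 1 / 12" "\<rho> \<ge> 0" by (simp_all add: \<rho>_def)
  define D where "D = (\<Sum>P\<in>pauli_index n. (1 / 12) ^ weight P * (cmod (x P))\<^sup>2)"
  define T where "T = (\<Sum>P\<in>pauli_index n. (cmod (x P))\<^sup>2)"
  define y where "y P = of_real (\<rho> ^ weight P) * x P" for P
  define Y where "Y = damped_comb n n \<rho> y"
  have D0: "D \<ge> 0" unfolding D_def by (intro sum_nonneg) auto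
  have T0: "T \<ge> 0" unfolding T_def by (intro sum_nonneg) auto
  have \<rho>w: "\<rho> ^ w * \<rho> ^ w = (1 / 12) ^ w" for w
    by (metis \<rho>(1) power_mult_distrib power2_eq_square)
  have "frob_inner (2 ^ n) (entries X) Y = 2 ^ n * (\<Sum>P\<in>pauli_index n. cnj (x P) * (of_real (\<rho> ^ weight P) * y P))"
    unfolding frob_inner_pauli_comb[symmetric]
    by (rule frob_inner_cong) (simp_all add: ent Y_def damped_comb_def pauli_comb_def)
  also have "(\<Sum>P\<in>pauli_index n. cnj (x P) * (of_real (\<rho> ^ weight P) * y P)) = of_real D"
    unfolding D_def of_real_sum
  proof (intro sum.cong refl)
    fix P
    have "cnj (x P) * (of_real (\<rho> ^ weight P) * y P) = of_real (\<rho> ^ weight P * \<rho> ^ weight P) * (x P * cnj (x P))"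
      by (simp add: y_def)
    also have "\<dots> = of_real ((1 / 12) ^ weight P * (cmod (x P))\<^sup>2)"
      unfolding \<rho>w complex_norm_square[symmetric] by simp
    finally show "cnj (x P) * (of_real (\<rho> ^ weight P) * y P) = of_real ((1 / 12) ^ weight P * (cmod (x P))\<^sup>2)" .
  qed
  finally have "frob_inner (2 ^ n) (entries X) Y = of_real (2 ^ n * D)" by simp
  then have frob_inner: "cmod (frob_inner (2 ^ n) (entries X) Y) = 2 ^ n * D"
    using D0 by (simp add: norm_mult norm_power)
  have frob_sq: "frob_sq (2 ^ n) (entries X) = 2 ^ n * T"
    unfolding T_def frob_sq_pauli_comb[symmetric] by (rule frob_sq_cong) (simp add: ent)
  have "(norm4 (2 ^ n) Y)\<^sup>2 \<le> sqrt (2 ^ n) * (\<Sum>P\<in>pauli_index n. (cmod (y P))\<^sup>2)"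
    unfolding Y_def by (rule pauli_hypercontractivity[OF \<rho>]) simp
  also have "(\<Sum>P\<in>pauli_index n. (cmod (y P))\<^sup>2) = D"
    unfolding D_def y_def norm_mult power_mult_distrib
    by (intro sum.cong refl) (simp add: \<rho>(2) norm_power power2_eq_square \<rho>w)
  finally have n4: "(norm4 (2 ^ n) Y)\<^sup>2 \<le> sqrt (2 ^ n) * D" .
  have S0: "(\<Sum>i<2 ^ n. s i) \<ge> 0"
    using s vec_l2_nonneg by (intro sum_nonneg) (metis lessThan_iff)
  have "(2 ^ n * D)\<^sup>2 \<le> (\<Sum>i<2 ^ n. s i) * sqrt (2 ^ n * T) * (norm4 (2 ^ n) Y)\<^sup>2"
    using frob_inner_trace_norm_duality[OF res unit s, of Y] unfolding frob_inner frob_sq .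
  also have "\<dots> \<le> (\<Sum>i<2 ^ n. s i) * sqrt (2 ^ n * T) * (sqrt (2 ^ n) * D)"
    using n4 S0 T0 by (intro mult_left_mono) auto
  also have "\<dots> = (\<Sum>i<2 ^ n. s i) * sqrt T * 2 ^ n * D"
    by (simp add: real_sqrt_mult)
  finally have "(2 ^ n * D) * (2 ^ n * D) \<le> ((\<Sum>i<2 ^ n. s i) * sqrt T) * (2 ^ n * D)"
    by (simp add: power2_eq_square mult_ac)
  \<comment> \<open>The damped energy \<open>D\<close> occurs twice on the left and once on the
    right, so one copy cancels; for \<open>D = 0\<close> the claim is nonnegativity.\<close>
  then have "2 ^ n * D \<le> (\<Sum>i<2 ^ n. s i) * sqrt T"
    using D0 S0 T0 by (cases "D = 0") (auto simp: mult_le_cancel_right)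
  then have "D \<le> ((\<Sum>i<2 ^ n. s i) * sqrt T) / 2 ^ n"
    by (simp add: field_simps)
  then show ?thesis by (simp add: D_def T_def)
qed

text \<open>Comparison of the normalised trace norm with the \<open>p\<close>-norm. The pointwise
  bound by \<open>t * (1 + (s i / t) powr p)\<close>, split at the threshold
  \<open>t = a powr (1 / p)\<close>, replaces convexity at the price of a factor 2.\<close>

lemma mean_le_powr_mean:
  fixes s :: "nat \<Rightarrow> real"
  assumes s: "\<And>i. s i \<ge> 0" and p: "p \<ge> 1"
    and a: "a = (\<Sum>i<N. s i powr p) / real N" "a > 0"
  shows "(\<Sum>i<N. s i) / real N \<le> 2 * a powr (1 / p)"
proof -
  define t where "t = a powr (1 / p)"
  have N: "real N > 0" using a by (cases "N = 0") auto
  have t: "t > 0" "t powr p = a" using a(2) p by (simp_all add: t_def powr_powr)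
  have "s i \<le> t * (1 + s i powr p / a)" for i
  proof (cases "s i \<le> t")
    case True
    then have "s i \<le> t * 1" by simp
    also have "\<dots> \<le> t * (1 + s i powr p / a)" using t(1) a(2) by (intro mult_left_mono) auto
    finally show ?thesis .
  next
    case False
    then have "1 \<le> s i / t" using t by simp
    then have "s i / t \<le> (s i / t) powr p" using p powr_mono[of 1 p "s i / t"] s[of i] t(1) by simp
    also have "\<dots> = s i powr p / a" using t s by (simp add: powr_divide)
    finally have "s i / t \<le> 1 + s i powr p / a" by simp
    then show ?thesis using t by (simp add: field_simps)
  qed
  then have "(\<Sum>i<N. s i) \<le> (\<Sum>i<N. t * (1 + s i powr p / a))" by (intro sum_mono)
  also have "\<dots> = t * (real N + (\<Sum>i<N. s i powr p) / a)"
    by (simp add: sum_distrib_left[symmetric] sum.distrib sum_divide_distrib)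
  also have "(\<Sum>i<N. s i powr p) / a = real N"
  proof -
    have "(\<Sum>i<N. s i powr p) = real N * a" using a(1) N by simp
    then show ?thesis using a(2) by simp
  qed
  finally show ?thesis using N by (simp add: t_def field_simps)
qed

text \<open>Estimates the share of the variance attributed to site \<open>j\<close>. Every singular
  value of \<open>d_site n j A\<close> is at most 2, which yields \<open>T \<le> 2 * a\<close> and
  hence the bound needed when the logarithm vanishes; the level splitting serves the range
  \<open>0 < a < 1\<close>.\<close>

lemma influence_bound:
  assumes A: "contraction (2 ^ n) (entries A)" and j: "1 \<le> j" "j \<le> n" and p: "1 \<le> p" "p < 2"
  defines "a \<equiv> schatten_norm n p (d_site n j A) powr p"
  shows "(\<Sum>P\<in>pauli_index n. (cmod (if P j = 0 then 0 else pauli_coeff n (entries A) P))\<^sup>2 / weight P)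
    \<le> 120 / (2 - p) * (a * (1 + a) / (1 + log_plus (1 / a)))"
proof -
  let ?N = "2 ^ n :: nat"
  define X where "X = d_site n j A"
  define x where "x P = (if P j = 0 then 0 else pauli_coeff n (entries A) P)" for P
  define V where "V = (\<Sum>P\<in>pauli_index n. (cmod (x P))\<^sup>2 / weight P)"
  define T where "T = (\<Sum>P\<in>pauli_index n. (cmod (x P))\<^sup>2)"
  have X: "X \<in> carrier_mat ?N ?N" unfolding X_def by (rule d_site_carrier)
  have ent: "entries X r c = pauli_comb n x r c" if "r < ?N" "c < ?N" for r c
    unfolding X_def x_def using that j by (rule pauli_comb_d_site)
  obtain u s where us: "\<forall>i. s i \<ge> 0" "\<forall>i<?N. vec_l2 ?N (u i) = 1"
    "\<forall>i<?N. vec_l2 ?N (apply_vec ?N (entries X) (u i)) = s i" "resolves_identity ?N u"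
    "\<forall>n' p. schatten_norm n' p X = ((\<Sum>i<?N. s i powr p) / 2 ^ n') powr (1 / p)"
    using singular_values_exist[OF X] by blast
  have a: "a = (\<Sum>i<?N. s i powr p) / 2 ^ n"
    unfolding a_def X_def[symmetric] using us(5) p by (intro schatten_powr_eq) (auto intro!: sum_nonneg)
  have a0: "a \<ge> 0" unfolding a by (intro divide_nonneg_nonneg sum_nonneg) auto
  have s2: "s i \<le> 2" if "i < ?N" for i
    using vec_l2_apply_vec_d_site_le[OF A j, of "u i"] us(2,3) that by (simp add: X_def)
  have T: "T \<le> 2 * a"
  proof -
    have "2 ^ n * T = frob_sq ?N (entries X)"
      unfolding T_def frob_sq_pauli_comb[symmetric] by (rule frob_sq_cong) (simp add: ent)
    also have "\<dots> = (\<Sum>i<?N. (s i)\<^sup>2)"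
      unfolding frob_sq_resolution[OF us(4)] using us(3) by (intro sum.cong refl) simp
    \<comment> \<open>Here \<open>p \<ge> 1\<close> enters: the factor
      \<open>s i powr (2 - p)\<close> is at most \<open>2 powr (2 - p) \<le> 2\<close>.\<close>
    also have "\<dots> \<le> (\<Sum>i<?N. 2 * s i powr p)"
    proof (rule sum_mono)
      fix i assume "i \<in> {..<?N}"
      then have i: "0 \<le> s i" "s i \<le> 2" using us(1) s2 by auto
      have "(s i)\<^sup>2 = s i powr (2 - p) * s i powr p"
        using i(1) by (cases "s i = 0") (simp_all add: powr_add[symmetric] powr_numeral)
      also have "\<dots> \<le> 2 powr (2 - p) * s i powr p"
        using i p by (intro mult_right_mono powr_mono2) auto
      also have "\<dots> \<le> 2 powr 1 * s i powr p"
        using p by (intro mult_right_mono powr_mono) auto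
      finally show "(s i)\<^sup>2 \<le> 2 * s i powr p" by simp
    qed
    also have "\<dots> = 2 ^ n * (2 * a)" by (simp add: a sum_distrib_left[symmetric])
    finally show ?thesis by simp
  qed
  have w: "weight P \<noteq> 0" if "P \<in> pauli_index n" "x P \<noteq> 0" for P
    using that weight_0_iff[of P n] by (auto simp: x_def split: if_splits)
  have "V \<le> T"
    unfolding V_def T_def
  proof (rule sum_mono)
    fix P assume P: "P \<in> pauli_index n"
    show "(cmod (x P))\<^sup>2 / weight P \<le> (cmod (x P))\<^sup>2"
    proof (cases "x P = 0")
      case False
      then have "real (weight P) \<ge> 1" using w[OF P] by simp
      then show ?thesis by (simp add: divide_le_eq mult_le_cancel_left1)
    qed simp
  qed
  then have V2: "V \<le> 2 * a" using T by simp
  have "V \<le> 120 / (2 - p) * (a * (1 + a) / (1 + log_plus (1 / a)))"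
  proof (cases "a = 0 \<or> a \<ge> 1")
    case True
    \<comment> \<open>At \<open>a = 0\<close> this rests on the default values of division and
      logarithm at 0.\<close>
    then have lp: "log_plus (1 / a) = 0" using a0 by (auto simp: log_plus_def max_def)
    have "2 \<le> 120 / (2 - p)" using p by (simp add: field_simps)
    then have "2 * a \<le> 120 / (2 - p) * (a * (1 + a))"
      using a0 p by (intro mult_mono) (auto simp: algebra_simps)
    then show ?thesis using V2 by (simp add: lp)
  next
    case False
    then have a01: "0 < a" "a < 1" using a0 by auto
    have lp: "log_plus (1 / a) = ln (1 / a)" using a01 by (simp add: log_plus_def ln_div)
    have ln1: "ln a \<le> 1" using ln_less_zero[OF a01] by linarith
    define D where "D = (\<Sum>P\<in>pauli_index n. (1 / 12) ^ weight P * (cmod (x P))\<^sup>2)"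
    have "D \<le> (\<Sum>i<?N. s i) / 2 ^ n * sqrt T"
      unfolding D_def T_def using us ent by (intro damped_energy_bound[where X=X and u=u]) auto
    also have "\<dots> \<le> (2 * a powr (1 / p)) * sqrt (2 * a)"
    proof (rule mult_mono)
      show "(\<Sum>i<?N. s i) / 2 ^ n \<le> 2 * a powr (1 / p)"
        using mean_le_powr_mean[of s p a ?N] us(1) p a a01 by simp
    qed (use T a01 T_def in \<open>auto intro!: sum_nonneg\<close>)
    also have "\<dots> = 2 * sqrt 2 * a powr (1 / 2 + 1 / p)"
      using a01 by (simp add: real_sqrt_mult powr_add powr_half_sqrt)
    \<comment> \<open>Rounding \<open>2 * sqrt 2\<close> up to 3 gives the constant assumed in
      \<open>level_split_numeric\<close>.\<close>
    also have "\<dots> \<le> 3 * a powr (1 / 2 + 1 / p)"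
      using real_le_lsqrt[of "3 / 2" 2] by (intro mult_right_mono) (simp_all add: power2_eq_square)
    finally have D: "D \<le> 3 * a powr (1 / 2 + 1 / p)" .
    have "V \<le> 12 ^ m * 3 * a powr (1 / 2 + 1 / p) + 2 * a / (real m + 1)" for m :: nat
    proof -
      have "V \<le> 12 ^ m * D + T / (real m + 1)"
        unfolding V_def D_def T_def by (rule weighted_sum_bound) (rule w)
      also have "\<dots> \<le> 12 ^ m * (3 * a powr (1 / 2 + 1 / p)) + 2 * a / (real m + 1)"
        using D T by (intro add_mono mult_left_mono divide_right_mono) auto
      finally show ?thesis by (simp add: mult.assoc)
    qed
    from level_split_numeric[OF a01 p this] have "V \<le> 120 / (2 - p) * (a / (1 + ln (1 / a)))" .
    also have "\<dots> \<le> 120 / (2 - p) * (a * (1 + a) / (1 + ln (1 / a)))"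
      using a01 p ln1 by (intro mult_left_mono divide_right_mono) (auto simp: ln_div algebra_simps)
    finally show ?thesis by (simp add: lp)
  qed
  then show ?thesis by (simp only: V_def x_def)
qed

text \<open>Subtracting the normalised trace removes exactly the coefficient of the identity string.
  Every other string has \<open>weight P\<close> sites in its support, and each of them receives the
  share \<open>1 / weight P\<close> of its squared coefficient.\<close>

lemma variance_decomposition:
  assumes A: "A \<in> carrier_mat (2 ^ n) (2 ^ n)"
  shows "mat_var n A = (\<Sum>j = 1..n. \<Sum>P\<in>pauli_index n.
    (cmod (if P j = 0 then 0 else pauli_coeff n (entries A) P))\<^sup>2 / weight P)"
proof -
  let ?N = "2 ^ n :: nat" and ?c = "pauli_coeff n (entries A)"
  let ?x = "\<lambda>P. if P = (\<lambda>_. 0) then 0 else ?c P"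
  define B where "B = A - (mat_trace A / 2 ^ n) \<cdot>\<^sub>m 1\<^sub>m (2 ^ n)"
  have B: "B \<in> carrier_mat ?N ?N" using A unfolding B_def by (intro minus_carrier_mat) simp
  have id: "pauli_string n (\<lambda>_. 0) r c = of_bool (r = c)" if rc: "r < ?N" "c < ?N" for r c
  proof (cases "r = c")
    case True
    then show ?thesis by (simp add: pauli_string_def pauli_def)
  next
    case False
    then obtain j where "j \<in> {1..n}" "site_bit n j r \<noteq> site_bit n j c"
      using site_bit_inj[OF rc] by blast
    then have "(\<Prod>j = 1..n. pauli 0 (site_bit n j r) (site_bit n j c)) = 0"
      by (intro prod_zero) (auto simp: pauli_def)
    then show ?thesis using False by (simp add: pauli_string_def)
  qed
  have tr: "?c (\<lambda>_. 0) = mat_trace A / 2 ^ n"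
  proof -
    have "frob_inner ?N (pauli_string n (\<lambda>_. 0)) (entries A) = (\<Sum>r<?N. \<Sum>c<?N. if r = c then entries A r c else 0)"
      unfolding frob_inner_def by (intro sum.cong refl) (simp add: id)
    then show ?thesis using A by (simp add: pauli_coeff_def mat_trace_def entries_def)
  qed
  have zero: "(\<lambda>_. 0) \<in> pauli_index n" by (simp add: pauli_index_def)
  have "entries B r c = pauli_comb n ?x r c" if "r < ?N" "c < ?N" for r c
  proof -
    have "entries B r c = pauli_comb n ?c r c - ?c (\<lambda>_. 0) * pauli_string n (\<lambda>_. 0) r c"
      using that A by (simp add: pauli_expansion id tr B_def entries_def)
    also have "\<dots> = pauli_comb n ?x r c"
      unfolding pauli_comb_def by (subst (1 2) sum.remove[OF finite_pauli_index zero]) simp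
    finally show ?thesis .
  qed
  then have "frob_sq ?N (entries B) = 2 ^ n * (\<Sum>P\<in>pauli_index n. (cmod (?x P))\<^sup>2)"
    unfolding frob_sq_pauli_comb[symmetric] by (rule frob_sq_cong)
  then have "mat_var n A = (\<Sum>P\<in>pauli_index n. (cmod (?x P))\<^sup>2)"
    unfolding mat_var_def B_def[symmetric] schatten_2_sq[OF B] by simp
  also have "\<dots> = (\<Sum>P\<in>pauli_index n. \<Sum>j = 1..n. (cmod (if P j = 0 then 0 else ?c P))\<^sup>2 / weight P)"
  proof (intro sum.cong refl)
    fix P assume P: "P \<in> pauli_index n"
    have "(\<Sum>j = 1..n. (cmod (if P j = 0 then 0 else ?c P))\<^sup>2 / weight P)
        = (\<Sum>j = 1..n. of_bool (P j \<noteq> 0) * ((cmod (?c P))\<^sup>2 / weight P))"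
      by (intro sum.cong refl) simp
    also have "\<dots> = real (weight P) * ((cmod (?c P))\<^sup>2 / weight P)"
      unfolding sum_distrib_right[symmetric] weight_eq_sum[OF P] by simp
    \<comment> \<open>For the identity string the weight is 0 and both sides vanish; otherwise the
      weight cancels.\<close>
    also have "\<dots> = (cmod (?x P))\<^sup>2" using weight_0_iff[OF P] by auto
    finally show "(cmod (?x P))\<^sup>2 = (\<Sum>j = 1..n. (cmod (if P j = 0 then 0 else ?c P))\<^sup>2 / weight P)" ..
  qed
  also have "\<dots> = (\<Sum>j = 1..n. \<Sum>P\<in>pauli_index n. (cmod (if P j = 0 then 0 else ?c P))\<^sup>2 / weight P)"
    by (rule sum.swap)
  finally show ?thesis .
qed

lemma talagrand_bound:
  assumes A: "A \<in> carrier_mat (2 ^ n) (2 ^ n)" "op_norm A \<le> 1" and p: "1 \<le> p" "p < 2"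
  shows "mat_var n A \<le> 120 / (2 - p) * (\<Sum>j = 1..n.
      if d_site n j A = 0\<^sub>m (2 ^ n) (2 ^ n) then 0
      else schatten_norm n p (d_site n j A) powr p
            * (1 + schatten_norm n p (d_site n j A) powr p)
            / (1 + log_plus (1 / schatten_norm n p (d_site n j A) powr p)))"
  unfolding variance_decomposition[OF A(1)] sum_distrib_left[of "120 / (2 - p)"]
proof (rule sum_mono)
  fix j assume "j \<in> {1..n}"
  then have j: "1 \<le> j" "j \<le> n" by auto
  let ?c = "pauli_coeff n (entries A)"
  show "(\<Sum>P\<in>pauli_index n. (cmod (if P j = 0 then 0 else ?c P))\<^sup>2 / weight P)
    \<le> 120 / (2 - p) * (if d_site n j A = 0\<^sub>m (2 ^ n) (2 ^ n) then 0
      else schatten_norm n p (d_site n j A) powr p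
            * (1 + schatten_norm n p (d_site n j A) powr p)
            / (1 + log_plus (1 / schatten_norm n p (d_site n j A) powr p)))"
  proof (cases "d_site n j A = 0\<^sub>m (2 ^ n) (2 ^ n)")
    case True
    \<comment> \<open>The convention that a vanishing \<open>d_site\<close> contributes 0 leaves no
      room on the right, so the share of this site must be exactly 0; Parseval shows this.\<close>
    have "2 ^ n * (\<Sum>P\<in>pauli_index n. (cmod (if P j = 0 then 0 else ?c P))\<^sup>2) = frob_sq (2 ^ n) (entries (d_site n j A))"
      unfolding frob_sq_pauli_comb[symmetric] by (rule frob_sq_cong) (simp add: pauli_comb_d_site[OF _ _ j])
    also have "\<dots> = 0" unfolding True by (simp add: frob_sq_def entries_def)
    finally have "\<forall>P\<in>pauli_index n. (cmod (if P j = 0 then 0 else ?c P))\<^sup>2 = 0"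
      by (simp add: sum_nonneg_eq_0_iff finite_pauli_index)
    then have "(\<Sum>P\<in>pauli_index n. (cmod (if P j = 0 then 0 else ?c P))\<^sup>2 / weight P) = 0"
      by (intro sum.neutral) auto
    then show ?thesis using True by simp
  next
    case False
    then show ?thesis using influence_bound[OF contraction_entries[OF A] j p] by simp
  qed
qed

theorem theorem3p6:
  shows "(\<exists>(Cp :: real \<Rightarrow> real) (C :: real). C > 0 \<and>
      (\<forall>p\<in>{1..<2}. Cp p > 0 \<and>
        (\<forall>n\<ge>1. \<forall>A\<in>carrier_mat (2 ^ n) (2 ^ n). op_norm A \<le> 1 \<longrightarrow>
          mat_var n A \<le> Cp p * (\<Sum>j = 1..n.
            if d_site n j A = 0\<^sub>m (2 ^ n) (2 ^ n) then 0
            else schatten_norm n p (d_site n j A) powr p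
                  * (1 + schatten_norm n p (d_site n j A) powr p)
                  / (1 + log_plus (1 / schatten_norm n p (d_site n j A) powr p))))) \<and>
      Cp \<sim>[at_left 2] (\<lambda>p. C / (2 - p)))
    \<and> (\<exists>C :: real. C > 0 \<and>
      (\<forall>n\<ge>1. \<forall>A\<in>carrier_mat (2 ^ n) (2 ^ n). op_norm A \<le> 1 \<longrightarrow>
        mat_var n A \<le> C * (\<Sum>j = 1..n.
          if d_site n j A = 0\<^sub>m (2 ^ n) (2 ^ n) then 0
          else schatten_norm n 1 (d_site n j A) * (1 + schatten_norm n 1 (d_site n j A))
                / (1 + log_plus (1 / schatten_norm n 1 (d_site n j A))))))"
proof
  show "\<exists>(Cp :: real \<Rightarrow> real) (C :: real). C > 0 \<and>
      (\<forall>p\<in>{1..<2}. Cp p > 0 \<and>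
        (\<forall>n\<ge>1. \<forall>A\<in>carrier_mat (2 ^ n) (2 ^ n). op_norm A \<le> 1 \<longrightarrow>
          mat_var n A \<le> Cp p * (\<Sum>j = 1..n.
            if d_site n j A = 0\<^sub>m (2 ^ n) (2 ^ n) then 0
            else schatten_norm n p (d_site n j A) powr p
                  * (1 + schatten_norm n p (d_site n j A) powr p)
                  / (1 + log_plus (1 / schatten_norm n p (d_site n j A) powr p))))) \<and>
      Cp \<sim>[at_left 2] (\<lambda>p. C / (2 - p))"
    \<comment> \<open>The constant equals its claimed asymptotic form, so the equivalence at 2 is
      reflexivity.\<close>
    by (rule exI[of _ "\<lambda>p. 120 / (2 - p)"], rule exI[of _ 120])
      (use talagrand_bound in \<open>simp add: asymp_equiv_refl\<close>)
  \<comment> \<open>Removing the exponent 1 requires a nonnegative base, which holds because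
    \<open>schatten_norm\<close> is itself a value of \<open>powr\<close>.\<close>
  have one: "schatten_norm n 1 X powr 1 = schatten_norm n 1 X" for n X
    by (simp add: schatten_norm_def)
  show "\<exists>C :: real. C > 0 \<and>
      (\<forall>n\<ge>1. \<forall>A\<in>carrier_mat (2 ^ n) (2 ^ n). op_norm A \<le> 1 \<longrightarrow>
        mat_var n A \<le> C * (\<Sum>j = 1..n.
          if d_site n j A = 0\<^sub>m (2 ^ n) (2 ^ n) then 0
          else schatten_norm n 1 (d_site n j A) * (1 + schatten_norm n 1 (d_site n j A))
                / (1 + log_plus (1 / schatten_norm n 1 (d_site n j A)))))"
    using talagrand_bound[where p = 1, unfolded one] by (intro exI[of _ 120]) simp
qed

end
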